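(* Let $S\in\mathbb{C}^{N\times N}[z_1,z_2]$ be a matrix polynomial with $S(z)^*S(z)=I_N$ for all $z\in\mathbb{T}^2$. Then there exist an integer $r\ge0$, an isometric $(N+r)\times(N+r)$ matrix $U=\begin{pmatrix}A&B\\ C&D\end{pmatrix}$ (with $A\in\mathbb{C}^{N\times N}$, $B\in\mathbb{C}^{N\times r}$, $C\in\mathbb{C}^{r\times N}$, $D\in\mathbb{C}^{r\times r}$), and orthogonal projections $P_1,P_2\in\mathbb{C}^{r\times r}$ with $P_1+P_2=I_r$, such that, with $\Delta(z_1,z_2)=z_1P_1+z_2P_2$, $$S(z)=A+B\Delta(z)(I-D\Delta(z))^{-1}C$$ and $\det(I-D\Delta(z))\equiv 1$.
   Context: $\mathbb{T}^2=\{(z_1,z_2)\in\mathbb{C}^2:|z_1|=|z_2|=1\}$. A matrix $U$ is isometric if $U^*U=I$. *)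

theory Defs
  imports
    "Jordan_Normal_Form.Schur_Decomposition"
    "Jordan_Normal_Form.Gauss_Jordan_Elimination"
begin

text \<open>
  The ring \<open>\<complex>[z\<^sub>1,z\<^sub>2]\<close> is represented as \<open>\<complex>[z\<^sub>1][z\<^sub>2]\<close>, that is, as \<open>complex poly poly\<close>:
  the outer indeterminate is \<open>z\<^sub>2\<close>, and the coefficients are polynomials in \<open>z\<^sub>1\<close>.
\<close>

definition eval2 :: "complex \<Rightarrow> complex \<Rightarrow> complex poly poly \<Rightarrow> complex" where
  "eval2 z1 z2 p = poly (poly p [:z2:]) z1"

abbreviation eval2_mat :: "complex poly poly mat \<Rightarrow> complex \<Rightarrow> complex \<Rightarrow> complex mat" where
  "eval2_mat S z1 z2 \<equiv> map_mat (eval2 z1 z2) S"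

definition isometric_mat :: "complex mat \<Rightarrow> bool" where
  "isometric_mat U \<longleftrightarrow> mat_adjoint U * U = 1\<^sub>m (dim_col U)"

definition orthogonal_projection :: "complex mat \<Rightarrow> bool" where
  "orthogonal_projection P \<longleftrightarrow> square_mat P \<and> P * P = P \<and> mat_adjoint P = P"

end

theory Submission
  imports Defs "HOL-Library.Poly_Mapping"
begin

text \<open>
  The proof follows Kummert's idea of realizing one variable at a time.  Write
  \<open>S(z\<^sub>1,z\<^sub>2) = \<Sum>\<^sub>k S\<^sub>k(z\<^sub>1) z\<^sub>2\<^sup>k\<close>.  For fixed \<open>z\<^sub>1\<close> on the circle this is a unitary-valued polynomial in
  \<open>z\<^sub>2\<close>, and it has the shift realization
  \<open>S = S\<^sub>0 + z\<^sub>2 P (I - z\<^sub>2 Z)\<^sup>-\<^sup>1 C\<^sub>0\<close>, where \<open>Z\<close> is the backward block shift, \<open>P\<close> reads off the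
  first block and \<open>C\<^sub>0\<close> is the column \<open>(S\<^sub>1,...,S\<^sub>n)\<close>.  This colligation is isometric only on the range of the
  block Hankel matrix \<open>H(z\<^sub>1) = (S\<^bsub>i+j+1\<^esub>(z\<^sub>1))\<close>.  Unitarity of \<open>S\<close> makes \<open>H\<close> a partial isometry on the
  circle (\<open>H H\<^sup>* = I - T T\<^sup>*\<close> with \<open>T\<close> the block Toeplitz matrix), so it remains to choose
  orthonormal bases \<open>V(z\<^sub>1)\<close> of its range for which the compressed colligation \<open>U(z\<^sub>1)\<close>
  is still a \<^emph>\<open>polynomial\<close> in \<open>z\<^sub>1\<close>.

  That choice is the heart of the matter (\<open>isometric_polynomial_frame\<close>).  Let \<open>M\<close> be the
  space of polynomial vectors \<open>f\<close> with \<open>f(z) \<in> ran H(z)\<close> on the circle.  As in the Beurling-Lax theorem,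
  the columns of \<open>V\<close> are an orthonormal basis of the wandering subspace \<open>M \<ominus> z M\<close>.
  The Hardy space is avoided: if \<open>H\<^sup>* f = a + b\<close> is split into the part \<open>a\<close> with
  exponents at most \<open>0\<close> and the part \<open>b\<close> with positive exponents, then
  \<open>f = H a + H b\<close> with \<open>H b \<in> z M\<close>, and \<open>H a \<in> M\<close> has degree at most \<open>deg H\<close>.  So modulo \<open>z M\<close> everything
  happens in polynomials of bounded degree, and finite-dimensional projections suffice.

  Thus \<open>S = A + z\<^sub>2 B (I - z\<^sub>2 D)\<^sup>-\<^sup>1 C\<close> where \<open>U = (A B; C D)\<close> is a polynomial
  in \<open>z\<^sub>1\<close>, isometric on the circle, and \<open>D\<close> is nilpotent (\<open>kummert_step\<close>).  The same step,
  applied to \<open>U\<close> regarded as a polynomial in the other variable, gives a constant isometric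
  matrix \<open>U\<^sub>f\<close> with \<open>U(z\<^sub>1) = A' + z\<^sub>1 B' (I - z\<^sub>1 D')\<^sup>-\<^sup>1 C'\<close>.  Regrouping the blocks of \<open>U\<^sub>f\<close>, with the two
  state spaces taken together, gives the required realization; both loops can be closed
  one after the other.  Because \<open>D(z\<^sub>1)\<close> and \<open>D'\<close> are nilpotent, the closed loop has
  no nonzero solution without input, at any \<open>(z\<^sub>1,z\<^sub>2)\<close>.  Hence the polynomial
  \<open>t \<mapsto> det (I - t D \<Delta>(z\<^sub>1,z\<^sub>2))\<close> has no zero, so it is constant, with value \<open>1\<close> at \<open>t = 0\<close>.
\<close>

section \<open>Laurent polynomials on the unit circle\<close>

type_synonym laurent = "int \<Rightarrow>\<^sub>0 complex"

abbreviation mon :: "int \<Rightarrow> complex \<Rightarrow> laurent" where "mon \<equiv> Poly_Mapping.single"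
abbreviation coef :: "laurent \<Rightarrow> int \<Rightarrow> complex" where "coef \<equiv> Poly_Mapping.lookup"
abbreviation supp :: "laurent \<Rightarrow> int set" where "supp \<equiv> Poly_Mapping.keys"

text \<open>
  On the unit circle \<open>cnj z = 1 / z\<close>, so complex conjugation of the values of a Laurent polynomial is this
  involution of the ring.  It turns matrix identities on the circle into identities over
  the ring of Laurent polynomials.
\<close>

definition lconj :: "laurent \<Rightarrow> laurent" where
  "lconj f = Poly_Mapping.map_key uminus (Poly_Mapping.map cnj f)"

lemma lookup_lconj [simp]: "coef (lconj f) k = cnj (coef f (- k))"
  by (auto simp add: lconj_def Poly_Mapping.map_key.rep_eq Poly_Mapping.map.rep_eq when_def)

lemma lconj_add: "lconj (f + g) = lconj f + lconj g"
  by (rule poly_mapping_eqI) (simp add: lookup_add)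

lemma lconj_zero [simp]: "lconj 0 = 0"
  by (rule poly_mapping_eqI) simp

lemma lconj_one [simp]: "lconj 1 = 1"
  by (rule poly_mapping_eqI) (simp add: lookup_one when_def)

lemma lconj_lconj [simp]: "lconj (lconj f) = f"
  by (rule poly_mapping_eqI) simp

lemma lconj_single [simp]: "lconj (mon k a) = mon (- k) (cnj a)"
  by (rule poly_mapping_eqI) (auto simp add: lookup_single when_def)

lemma laurent_as_sum: "f = (\<Sum>k\<in>supp f. mon k (coef f k))" for f :: laurent
proof (rule poly_mapping_eqI)
  fix j
  show "coef f j = coef (\<Sum>k\<in>supp f. mon k (coef f k)) j"
    by (simp add: lookup_sum lookup_single when_def in_keys_iff)
qed

lemma supp_bounded:
  obtains N :: nat where "supp f \<subseteq> {- int N..int N}"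
proof
  show "supp f \<subseteq> {- int (nat (\<Sum>k\<in>supp f. \<bar>k\<bar>))..int (nat (\<Sum>k\<in>supp f. \<bar>k\<bar>))}"
  proof
    fix k assume "k \<in> supp f"
    then have "\<bar>k\<bar> \<le> (\<Sum>k\<in>supp f. \<bar>k\<bar>)" by (intro member_le_sum) auto
    then show "k \<in> {- int (nat (\<Sum>k\<in>supp f. \<bar>k\<bar>))..int (nat (\<Sum>k\<in>supp f. \<bar>k\<bar>))}" by auto
  qed
qed

text \<open>
  Conjugation and evaluation are visibly multiplicative on monomials; additivity does the rest.
\<close>

lemma multiplicative_if_on_monomials:
  fixes \<phi> :: "laurent \<Rightarrow> 'a::comm_ring_1"
  assumes add: "\<And>f g. \<phi> (f + g) = \<phi> f + \<phi> g"
    and mono: "\<And>k l a b. \<phi> (mon (k + l) (a * b))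
                 = \<phi> (mon k a) * \<phi> (mon l b)"
  shows "\<phi> (f * g) = \<phi> f * \<phi> g"
proof -
  have "\<phi> 0 + \<phi> 0 = \<phi> 0" using add[of 0 0] by simp
  then have zero: "\<phi> 0 = 0" by simp
  have hom_sum: "\<phi> (sum h X) = (\<Sum>x\<in>X. \<phi> (h x))" for h :: "int \<Rightarrow> laurent" and X
    by (induction X rule: infinite_finite_induct) (simp_all add: zero add)
  let ?f = "\<lambda>k. mon k (coef f k)" and ?g = "\<lambda>k. mon k (coef g k)"
  have "\<phi> (f * g) = \<phi> ((\<Sum>k\<in>supp f. ?f k) * (\<Sum>l\<in>supp g. ?g l))"
    by (simp flip: laurent_as_sum)
  also have "\<dots> = (\<Sum>k\<in>supp f. \<Sum>l\<in>supp g. \<phi> (?f k) * \<phi> (?g l))"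
    by (simp add: sum_product hom_sum mult_single mono)
  also have "\<dots> = (\<Sum>k\<in>supp f. \<phi> (?f k)) * (\<Sum>l\<in>supp g. \<phi> (?g l))"
    by (simp add: sum_product)
  also have "\<dots> = \<phi> f * \<phi> g"
    by (simp flip: hom_sum laurent_as_sum)
  finally show ?thesis .
qed

lemma lconj_mult: "lconj (f * g) = lconj f * lconj g"
  by (rule multiplicative_if_on_monomials) (simp_all add: lconj_add mult_single)

lemma lconj_sum: "lconj (sum h X) = (\<Sum>x\<in>X. lconj (h x))"
  by (induction X rule: infinite_finite_induct) (simp_all add: lconj_add)

definition leval :: "complex \<Rightarrow> laurent \<Rightarrow> complex" where
  "leval z f = (\<Sum>k\<in>supp f. coef f k * z powi k)"

lemma leval_superset:
  assumes "finite K" "supp f \<subseteq> K"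
  shows "leval z f = (\<Sum>k\<in>K. coef f k * z powi k)"
  unfolding leval_def using assms by (intro sum.mono_neutral_left) (auto simp: in_keys_iff)

lemma leval_add: "leval z (f + g) = leval z f + leval z g"
proof -
  let ?K = "supp f \<union> supp g"
  have "leval z (f + g) = (\<Sum>k\<in>?K. coef (f + g) k * z powi k)"
    by (rule leval_superset) (use keys_add[of f g] in auto)
  also have "\<dots> = leval z f + leval z g"
    by (simp add: leval_superset[of ?K f] leval_superset[of ?K g] lookup_add distrib_right sum.distrib)
  finally show ?thesis .
qed

lemma leval_single [simp]: "leval z (mon k a) = a * z powi k"
  by (cases "a = 0") (simp_all add: leval_def)

lemma leval_zero [simp]: "leval z 0 = 0"
  by (simp add: leval_def)

lemma leval_one [simp]: "leval z 1 = 1"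
  using leval_single[of z 0 1] by (simp del: leval_single)

lemma leval_mult:
  assumes "z \<noteq> 0"
  shows "leval z (f * g) = leval z f * leval z g"
  by (rule multiplicative_if_on_monomials)
    (simp_all add: leval_add assms power_int_add)

lemma leval_lconj:
  assumes "cmod z = 1"
  shows "leval z (lconj f) = cnj (leval z f)"
proof -
  have z: "z \<noteq> 0" using assms by auto
  have "z * cnj z = 1"
    using assms by (simp flip: complex_norm_square)
  then have "cnj z = inverse z"
    using z by (simp add: field_simps)
  then have pw: "cnj (z powi k) = z powi (- k)" for k
    by (simp add: power_int_minus power_int_inverse)
  have "leval z (lconj f) = (\<Sum>k\<in>uminus ` supp f. coef (lconj f) k * z powi k)"
    by (rule leval_superset) (force simp: in_keys_iff image_iff)+
  also have "\<dots> = (\<Sum>k\<in>supp f. cnj (coef f k) * z powi (- k))"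
    by (subst sum.reindex) (simp_all add: inj_on_def)
  also have "\<dots> = cnj (leval z f)"
    by (simp add: leval_def pw del: complex_cnj_power_int)
  finally show ?thesis .
qed

definition lpoly :: "complex poly \<Rightarrow> laurent" where
  "lpoly p = (\<Sum>k\<le>degree p. mon (int k) (coeff p k))"

lemma lookup_lpoly [simp]: "coef (lpoly p) k = (if k < 0 then 0 else coeff p (nat k))"
proof -
  have "coef (lpoly p) k = (\<Sum>j\<le>degree p. if j = nat k \<and> k \<ge> 0 then coeff p (nat k) else 0)"
    by (auto simp: lpoly_def lookup_sum lookup_single when_def intro!: sum.cong)
  then show ?thesis
    by (auto simp: coeff_eq_0 not_le)
qed

lemma lpoly_inject [simp]: "lpoly p = lpoly q \<longleftrightarrow> p = q"
proof
  assume h: "lpoly p = lpoly q"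
  show "p = q"
  proof (rule poly_eqI)
    fix n
    have "coef (lpoly p) (int n) = coef (lpoly q) (int n)" by (simp only: h)
    then show "coeff p n = coeff q n" by simp
  qed
qed simp

lemma lpoly_add: "lpoly (p + q) = lpoly p + lpoly q"
  by (rule poly_mapping_eqI) (simp add: lookup_add)

lemma lpoly_zero [simp]: "lpoly 0 = 0"
  by (rule poly_mapping_eqI) simp

lemma lpoly_const [simp]: "lpoly [:c:] = mon 0 c"
  by (simp add: lpoly_def)

lemma lpoly_one [simp]: "lpoly 1 = 1"
  by (simp add: lpoly_const one_pCons)

lemma lookup_monomial_mult: "coef (mon j a * f) k = a * coef f (k - j)" for f :: laurent
proof -
  have "coef (mon j a * f) k =
     coef (\<Sum>l\<in>supp f. mon (j + l) (a * coef f l)) k"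
    by (subst laurent_as_sum[of f]) (simp only: sum_distrib_left mult_single)
  also have "\<dots> = (\<Sum>l\<in>supp f. if l = k - j then a * coef f l else 0)"
    unfolding lookup_sum by (intro sum.cong) (auto simp: lookup_single when_def)
  also have "\<dots> = a * coef f (k - j)"
    by (simp add: in_keys_iff)
  finally show ?thesis .
qed

lemma lpoly_pCons: "lpoly (pCons a p) = mon 0 a + mon 1 1 * lpoly p"
proof (rule poly_mapping_eqI)
  fix k :: int
  consider "k < 0" | "k = 0" | "k > 0" by linarith
  then show "coef (lpoly (pCons a p)) k = coef (mon 0 a + mon 1 1 * lpoly p) k"
  proof cases
    case 3
    then have "nat k = Suc (nat (k - 1))" by linarith
    then show ?thesis
      using 3 by (simp add: lookup_add lookup_monomial_mult lookup_single when_def)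
  qed (simp_all add: lookup_add lookup_monomial_mult lookup_single when_def)
qed

lemma lpoly_mult: "lpoly (p * q) = lpoly p * lpoly q"
proof (induction p)
  case (pCons a p)
  have s: "lpoly (smult a q) = mon 0 a * lpoly q"
    by (rule poly_mapping_eqI) (simp add: lookup_monomial_mult)
  have "lpoly (pCons a p * q) = lpoly (smult a q) + lpoly (pCons 0 (p * q))"
    by (simp add: lpoly_add)
  also have "\<dots> = lpoly (pCons a p) * lpoly q"
    by (simp add: s lpoly_pCons pCons.IH algebra_simps)
  finally show ?case .
qed simp

lemma leval_lpoly:
  assumes "z \<noteq> 0"
  shows "leval z (lpoly p) = poly p z"
  by (induction p) (simp_all add: lpoly_pCons leval_add leval_mult assms)

lemma lpoly_surj:
  assumes "supp f \<subseteq> {0..}"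
  obtains p where "f = lpoly p"
proof -
  obtain n :: nat where n: "supp f \<subseteq> {- int n..int n}" by (rule supp_bounded)
  have c: "coeff (Abs_poly (\<lambda>k. coef f (int k))) k = coef f (int k)" for k
  proof -
    have "coef f (int i) = 0" if "i > n" for i
    proof -
      have "int i \<notin> supp f" using n that by auto
      then show ?thesis by (simp add: in_keys_iff)
    qed
    then show ?thesis by (simp add: coeff_Abs_poly[of n])
  qed
  have "f = lpoly (Abs_poly (\<lambda>k. coef f (int k)))"
  proof (rule poly_mapping_eqI)
    fix k show "coef f k = coef (lpoly (Abs_poly (\<lambda>k. coef f (int k)))) k"
      using assms by (cases "k \<in> supp f") (auto simp: c in_keys_iff)
  qed
  then show ?thesis by (rule that)
qed

lemma infinite_unit_circle: "infinite {z. cmod z = 1}"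
proof
  assume "finite {z. cmod z = 1}"
  moreover have "cis ` {0<..<1} \<subseteq> {z. cmod z = 1}" by auto
  ultimately have "finite (cis ` {0<..<1})" by (rule rev_finite_subset)
  moreover have "inj_on cis {0<..<1}"
  proof (rule inj_onI)
    fix x y :: real assume "x \<in> {0<..<1}" "y \<in> {0<..<1}" "cis x = cis y"
    then have "0 \<le> x" "x \<le> pi" "0 \<le> y" "y \<le> pi" "cos x = cos y"
      using pi_ge_two by (auto simp: complex_eq_iff)
    then show "x = y" by (rule cos_inj_pi)
  qed
  ultimately show False
    using infinite_Ioo[of "0::real" 1] by (simp add: finite_image_iff)
qed

text \<open>
  After multiplication by a power of \<open>z\<close> the values are those of an ordinary
  polynomial, which would have infinitely many roots.
\<close>

lemma laurent_eq_zeroI: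
  assumes "\<And>z. cmod z = 1 \<Longrightarrow> leval z f = 0"
  shows "f = 0"
proof -
  obtain N :: nat where N: "supp f \<subseteq> {- int N..int N}" by (rule supp_bounded)
  let ?Z = "mon (int N) (1::complex)"
  have "supp (?Z * f) \<subseteq> {0..}"
  proof
    fix k assume "k \<in> supp (?Z * f)"
    then have "k - int N \<in> supp f" by (simp add: in_keys_iff lookup_monomial_mult)
    then show "k \<in> {0..}" using N by auto
  qed
  then obtain p where p: "?Z * f = lpoly p" by (rule lpoly_surj)
  have "poly p z = 0" if "cmod z = 1" for z
  proof -
    have z: "z \<noteq> 0" using that by auto
    have "poly p z = leval z (?Z * f)" by (simp add: p leval_lpoly z)
    then show ?thesis by (simp add: leval_mult z assms that)
  qed
  then have "{z. cmod z = 1} \<subseteq> {z. poly p z = 0}" by auto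
  then have "p = 0" using infinite_unit_circle poly_roots_finite finite_subset by blast
  then have "?Z * f = 0" using p by simp
  then have "coef (?Z * f) (k + int N) = 0" for k
    by (simp only: lookup_zero)
  then have "coef f k = 0" for k
    by (simp add: lookup_monomial_mult)
  then show "f = 0" by (intro poly_mapping_eqI) simp
qed

section \<open>Laurent polynomial matrices and their inner product\<close>

text \<open>
  The adjoint for the involution \<open>lconj\<close>; at each point of the unit circle its value is the
  usual adjoint.
\<close>

definition adj :: "laurent mat \<Rightarrow> laurent mat" where
  "adj A = mat (dim_col A) (dim_row A) (\<lambda>(i, j). lconj (A $$ (j, i)))"

lemma adj_carrier [simp]: "A \<in> carrier_mat n m \<Longrightarrow> adj A \<in> carrier_mat m n"
  by (auto simp: adj_def)

lemma dim_adj [simp]: "dim_row (adj A) = dim_col A" "dim_col (adj A) = dim_row A"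
  by (auto simp: adj_def)

lemma index_adj [simp]:
  "i < dim_col A \<Longrightarrow> j < dim_row A \<Longrightarrow> adj A $$ (i, j) = lconj (A $$ (j, i))"
  by (simp add: adj_def)

lemma adj_adj [simp]: "adj (adj A) = A"
  by (rule eq_matI) auto

lemma adj_zero [simp]: "adj (0\<^sub>m n m) = 0\<^sub>m m n"
  by (rule eq_matI) auto

lemma adj_mult:
  assumes "A \<in> carrier_mat n m" "B \<in> carrier_mat m k"
  shows "adj (A * B) = adj B * adj A"
proof (rule eq_matI)
  fix i j assume "i < dim_row (adj B * adj A)" "j < dim_col (adj B * adj A)"
  then show "adj (A * B) $$ (i, j) = (adj B * adj A) $$ (i, j)"
    using assms by (simp add: scalar_prod_def lconj_sum lconj_mult mult.commute)
qed (use assms in auto)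

lemma adj_add:
  assumes "A \<in> carrier_mat n m" "B \<in> carrier_mat n m"
  shows "adj (A + B) = adj A + adj B"
  using assms by (intro eq_matI) (auto simp: lconj_add)

text \<open>
  The case \<open>K = {0..}\<close> describes the polynomial matrices among the Laurent polynomial ones.
\<close>

definition entries_in :: "int set \<Rightarrow> laurent mat \<Rightarrow> bool" where
  "entries_in K A \<longleftrightarrow> (\<forall>i<dim_row A. \<forall>j<dim_col A. supp (A $$ (i, j)) \<subseteq> K)"

lemma entries_in_mono: "entries_in K A \<Longrightarrow> K \<subseteq> K' \<Longrightarrow> entries_in K' A"
  unfolding entries_in_def by blast

lemma entries_in_mult:
  assumes "entries_in K A" "entries_in K' B" "A \<in> carrier_mat n m" "B \<in> carrier_mat m k"
    and "\<And>a b. a \<in> K \<Longrightarrow> b \<in> K' \<Longrightarrow> a + b \<in> K''"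
  shows "entries_in K'' (A * B)"
  unfolding entries_in_def
proof (intro allI impI)
  fix i j assume "i < dim_row (A * B)" "j < dim_col (A * B)"
  then have i: "i < n" and j: "j < k" using assms by auto
  have "(A * B) $$ (i, j) = (\<Sum>l<m. A $$ (i, l) * B $$ (l, j))"
    using i j assms(3,4) by (simp add: scalar_prod_def lessThan_atLeast0)
  moreover have "supp (A $$ (i, l) * B $$ (l, j)) \<subseteq> K''" if l: "l < m" for l
  proof -
    have "supp (A $$ (i, l)) \<subseteq> K" "supp (B $$ (l, j)) \<subseteq> K'"
      using assms i j l by (auto simp: entries_in_def)
    then show ?thesis
      using keys_mult[of "A $$ (i, l)" "B $$ (l, j)"] assms(5) by blast
  qed
  ultimately show "supp ((A * B) $$ (i, j)) \<subseteq> K''"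
    using keys_sum[of "\<lambda>l. A $$ (i, l) * B $$ (l, j)" "{..<m}"] by fastforce
qed

lemma entries_in_add:
  assumes "entries_in K A" "entries_in K B" "A \<in> carrier_mat n m" "B \<in> carrier_mat n m"
  shows "entries_in K (A + B)"
  unfolding entries_in_def
proof (intro allI impI)
  fix i j assume "i < dim_row (A + B)" "j < dim_col (A + B)"
  then show "supp ((A + B) $$ (i, j)) \<subseteq> K"
    using assms keys_add[of "A $$ (i, j)" "B $$ (i, j)"] unfolding entries_in_def by fastforce
qed

lemma entries_in_minus:
  assumes "entries_in K A" "entries_in K B" "A \<in> carrier_mat n m" "B \<in> carrier_mat n m"
  shows "entries_in K (A - B)"
  unfolding entries_in_def
proof (intro allI impI)
  fix i j assume "i < dim_row (A - B)" "j < dim_col (A - B)"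
  then show "supp ((A - B) $$ (i, j)) \<subseteq> K"
    using assms keys_diff[of "A $$ (i, j)" "B $$ (i, j)"] unfolding entries_in_def by fastforce
qed

lemma entries_in_zero [simp]: "entries_in K (0\<^sub>m n m)"
  by (simp add: entries_in_def)

lemma entries_in_adj: "entries_in K A \<Longrightarrow> (\<And>k. - k \<in> K \<Longrightarrow> k \<in> K') \<Longrightarrow> entries_in K' (adj A)"
  unfolding entries_in_def
  by (auto simp: in_keys_iff) (metis in_keys_iff minus_minus subsetD)

text \<open>
  On columns, the constant coefficient of \<open>g\<^sup>* f\<close> is the \<open>L\<^sup>2\<close> inner product over the unit circle.
\<close>

definition ip :: "laurent mat \<Rightarrow> laurent mat \<Rightarrow> complex" where
  "ip f g = coef ((adj g * f) $$ (0, 0)) 0"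

context fixes m :: nat begin

lemma ip_altdef:
  assumes "f \<in> carrier_mat m 1" "g \<in> carrier_mat m 1"
  shows "ip f g = (\<Sum>i<m. coef (lconj (g $$ (i, 0)) * f $$ (i, 0)) 0)"
  using assms by (simp add: ip_def scalar_prod_def lookup_sum lessThan_atLeast0)

lemma ip_add_left:
  assumes "f \<in> carrier_mat m 1" "g \<in> carrier_mat m 1" "h \<in> carrier_mat m 1"
  shows "ip (f + g) h = ip f h + ip g h"
  using assms by (simp add: ip_altdef lookup_add distrib_left sum.distrib)

lemma ip_diff_left:
  assumes "f \<in> carrier_mat m 1" "g \<in> carrier_mat m 1" "h \<in> carrier_mat m 1"
  shows "ip (f - g) h = ip f h - ip g h"
  using assms by (simp add: ip_altdef lookup_minus right_diff_distrib sum_subtractf minus_carrier_mat)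

lemma ip_scale_left:
  assumes "f \<in> carrier_mat m 1" "h \<in> carrier_mat m 1"
  shows "ip (mon 0 c \<cdot>\<^sub>m f) h = c * ip f h"
  using assms
  by (simp add: ip_altdef lookup_monomial_mult mult.left_commute[of _ "mon 0 c"] sum_distrib_left)

lemma ip_zero_left [simp]: "h \<in> carrier_mat m 1 \<Longrightarrow> ip (0\<^sub>m m 1) h = 0"
  by (simp add: ip_altdef)

lemma ip_commute:
  assumes "f \<in> carrier_mat m 1" "g \<in> carrier_mat m 1"
  shows "ip g f = cnj (ip f g)"
proof -
  have *: "coef (lconj a * b) 0 = cnj (coef (lconj b * a) 0)" for a b
  proof -
    have "lconj a * b = lconj (lconj b * a)" by (simp add: lconj_mult mult.commute)
    then show ?thesis by simp
  qed
  show ?thesis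
    unfolding ip_altdef[OF assms] ip_altdef[OF assms(2,1)] cnj_sum by (intro sum.cong refl *)
qed

lemma ip_add_right:
  assumes "f \<in> carrier_mat m 1" "g \<in> carrier_mat m 1" "h \<in> carrier_mat m 1"
  shows "ip h (f + g) = ip h f + ip h g"
  using assms ip_commute[of "f + g" h] ip_commute[of f h] ip_commute[of g h] ip_add_left[of f g h]
  by simp

lemma ip_scale_right:
  assumes "f \<in> carrier_mat m 1" "h \<in> carrier_mat m 1"
  shows "ip h (mon 0 c \<cdot>\<^sub>m f) = cnj c * ip h f"
  using assms ip_commute[of "mon 0 c \<cdot>\<^sub>m f" h] ip_commute[of f h] ip_scale_left[of f h c]
  by simp

lemma ip_mult_left:
  assumes "A \<in> carrier_mat m n" "f \<in> carrier_mat n 1" "g \<in> carrier_mat m 1"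
  shows "ip (A * f) g = ip f (adj A * g)"
  using assms by (simp add: ip_def adj_mult[of _ n m _ 1] assoc_mult_mat[of _ 1 m _ n _ 1])

lemma coef_lconj_mult_self: "coef (lconj a * a) 0 = (\<Sum>k\<in>supp a. (cmod (coef a k))\<^sup>2)"
proof -
  have "lconj a * a = (\<Sum>k\<in>supp a. mon (- k) (cnj (coef a k)) * a)"
    by (subst laurent_as_sum[of a]) (simp only: lconj_sum lconj_single sum_distrib_right)
  then show ?thesis
    by (simp add: lookup_sum lookup_monomial_mult mult.commute[of "cnj _"] flip: complex_norm_square)
qed

text \<open>
  By Parseval's identity \<open>ip f f\<close> is the sum of the squared moduli of all coefficients.
\<close>

lemma ip_self:
  assumes "f \<in> carrier_mat m 1"
  obtains "ip f f = 0" "f = 0\<^sub>m m 1" | x where "ip f f = of_real x" "x > 0"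
proof -
  define x where "x = (\<Sum>i<m. \<Sum>k\<in>supp (f $$ (i, 0)). (cmod (coef (f $$ (i, 0)) k))\<^sup>2)"
  have ip: "ip f f = of_real x"
    using assms by (simp add: ip_altdef coef_lconj_mult_self x_def)
  have "x \<ge> 0" unfolding x_def by (intro sum_nonneg) auto
  show ?thesis
  proof (cases "x = 0")
    case True
    have "coef (f $$ (i, 0)) k = 0" if "i < m" for i k
    proof -
      have "(\<Sum>k\<in>supp (f $$ (i, 0)). (cmod (coef (f $$ (i, 0)) k))\<^sup>2) = 0"
        using True that unfolding x_def
        by (subst (asm) sum_nonneg_eq_0_iff) (auto intro!: sum_nonneg)
      then show ?thesis
        by (subst (asm) sum_nonneg_eq_0_iff) (auto simp: in_keys_iff)
    qed
    then have "f = 0\<^sub>m m 1"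
      using assms by (intro eq_matI poly_mapping_eqI) auto
    then show ?thesis using that(1) ip True by simp
  next
    case False
    then show ?thesis using that(2) ip \<open>x \<ge> 0\<close> by auto
  qed
qed

lemma ip_self_eq_zeroD: "f \<in> carrier_mat m 1 \<Longrightarrow> ip f f = 0 \<Longrightarrow> f = 0\<^sub>m m 1"
  using ip_self[of f] by (metis less_irrefl of_real_eq_0_iff)

definition is_subspace :: "laurent mat set \<Rightarrow> bool" where
  "is_subspace L \<longleftrightarrow> L \<subseteq> carrier_mat m 1 \<and> 0\<^sub>m m 1 \<in> L \<and>
     (\<forall>f\<in>L. \<forall>g\<in>L. f + g \<in> L) \<and> (\<forall>c. \<forall>f\<in>L. mon 0 c \<cdot>\<^sub>m f \<in> L)"

text \<open>
  The space of all columns has infinite dimension over the complex numbers; that \<open>L\<close> is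
  finite-dimensional is expressed by a finite set \<open>K\<close> of coefficient positions that separates its elements.
  The induction over \<open>K\<close> is the Gram-Schmidt process: dropping a position \<open>(i, k)\<close> replaces \<open>L\<close> by the
  hyperplane \<open>L0\<close> where that coefficient vanishes, and the projection onto \<open>L0\<close>
  yields the one basis vector that is missing.  Completeness is stated as the absence of nonzero
  vectors orthogonal to the basis, the form in which it is needed later.
\<close>

lemma orthonormal_basis_and_projection:
  assumes "finite K" "\<And>i k. (i, k) \<in> K \<Longrightarrow> i < m" "is_subspace L"
    and "\<And>f. f \<in> L \<Longrightarrow> (\<And>i k. (i, k) \<in> K \<Longrightarrow> coef (f $$ (i, 0)) k = 0) \<Longrightarrow> f = 0\<^sub>m m 1"
  shows "\<exists>bs. set bs \<subseteq> L \<and>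
           (\<forall>i<length bs. \<forall>j<length bs. ip (bs ! i) (bs ! j) = (if i = j then 1 else 0)) \<and>
           (\<forall>f\<in>L. (\<forall>b\<in>set bs. ip f b = 0) \<longrightarrow> f = 0\<^sub>m m 1) \<and>
           (\<forall>f\<in>carrier_mat m 1. \<exists>l\<in>L. \<forall>g\<in>L. ip (f - l) g = 0)"
  using assms
proof (induction K arbitrary: L rule: finite_induct)
  case empty
  then have L: "L = {0\<^sub>m m 1}" by (auto simp: is_subspace_def)
  have "ip (f - 0\<^sub>m m 1) (0\<^sub>m m 1) = 0" if "f \<in> carrier_mat m 1" for f
  proof -
    have "f - 0\<^sub>m m 1 \<in> carrier_mat m 1" by (simp add: minus_carrier_mat)
    then show ?thesis using ip_commute[of "0\<^sub>m m 1" "f - 0\<^sub>m m 1"] ip_zero_left[of "f - 0\<^sub>m m 1"] by simp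
  qed
  with L show ?case by (intro exI[of _ "[]"]) simp
next
  case (insert p K)
  obtain i k where p: "p = (i, k)" by (cases p)
  then have i: "i < m" using insert.prems by blast
  define \<phi> where "\<phi> f = coef (f $$ (i, 0)) k" for f :: "laurent mat"
  have \<phi>_add: "\<phi> (f + g) = \<phi> f + \<phi> g" if "f \<in> carrier_mat m 1" "g \<in> carrier_mat m 1" for f g
    using that i by (simp add: \<phi>_def lookup_add)
  have \<phi>_scale: "\<phi> (mon 0 c \<cdot>\<^sub>m f) = c * \<phi> f" if "f \<in> carrier_mat m 1" for f c
    using that i by (simp add: \<phi>_def lookup_monomial_mult)
  have carr: "f \<in> carrier_mat m 1" if "f \<in> L" for f
    using insert.prems that by (auto simp: is_subspace_def)
  have Ladd: "f + g \<in> L" if "f \<in> L" "g \<in> L" for f g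
    using insert.prems that by (auto simp: is_subspace_def)
  have Lscale: "mon 0 c \<cdot>\<^sub>m f \<in> L" if "f \<in> L" for f c
    using insert.prems that by (auto simp: is_subspace_def)
  define L0 where "L0 = {f \<in> L. \<phi> f = 0}"
  have L0: "is_subspace L0"
    using insert.prems(2) i unfolding is_subspace_def L0_def
    by (auto simp: subset_iff \<phi>_add \<phi>_scale) (simp add: \<phi>_def)
  have "\<exists>bs. set bs \<subseteq> L0 \<and>
           (\<forall>i<length bs. \<forall>j<length bs. ip (bs ! i) (bs ! j) = (if i = j then 1 else 0)) \<and>
           (\<forall>f\<in>L0. (\<forall>b\<in>set bs. ip f b = 0) \<longrightarrow> f = 0\<^sub>m m 1) \<and>
           (\<forall>f\<in>carrier_mat m 1. \<exists>l\<in>L0. \<forall>g\<in>L0. ip (f - l) g = 0)"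
  proof (rule insert.IH[OF _ L0])
    fix f assume "f \<in> L0" and z: "\<And>i k. (i, k) \<in> K \<Longrightarrow> coef (f $$ (i, 0)) k = 0"
    then show "f = 0\<^sub>m m 1"
      using insert.prems(3)[of f] unfolding L0_def p \<phi>_def by blast
  qed (use insert.prems in blast)
  then obtain bs where bs: "set bs \<subseteq> L0"
    and on: "\<forall>i<length bs. \<forall>j<length bs. ip (bs ! i) (bs ! j) = (if i = j then 1 else 0)"
    and compl: "\<forall>f\<in>L0. (\<forall>b\<in>set bs. ip f b = 0) \<longrightarrow> f = 0\<^sub>m m 1"
    and proj: "\<forall>f\<in>carrier_mat m 1. \<exists>l\<in>L0. \<forall>g\<in>L0. ip (f - l) g = 0"
    by (elim exE conjE)
  show ?case
  proof (cases "L0 = L")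
    case True
    then show ?thesis using bs on compl proj by (intro exI[of _ bs] conjI) simp_all
  next
    case False
    then obtain l where l: "l \<in> L" "\<phi> l \<noteq> 0" unfolding L0_def by auto
    obtain q where q: "q \<in> L0" "\<And>g. g \<in> L0 \<Longrightarrow> ip (l - q) g = 0"
      using proj carr l by blast
    have qL: "q \<in> L" "\<phi> q = 0" using q by (auto simp: L0_def)
    define e where "e = l - q"
    have "l - q = l + mon 0 (-1) \<cdot>\<^sub>m q"
    proof -
      have "mon 0 (-1) = - 1" by (simp add: single_uminus)
      then show ?thesis using carr[OF l(1)] carr[OF qL(1)] by (intro eq_matI) auto
    qed
    then have e: "e \<in> L" "\<phi> e \<noteq> 0"
      using l qL carr by (auto simp: e_def Ladd Lscale \<phi>_add \<phi>_scale)
    have "e \<noteq> 0\<^sub>m m 1" using e(2) i by (auto simp: \<phi>_def)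
    then obtain x where x: "ip e e = of_real x" "x > 0"
      using ip_self[OF carr[OF e(1)]] by metis
    define u where "u = mon 0 (of_real (1 / sqrt x)) \<cdot>\<^sub>m e"
    have uL: "u \<in> L" "u \<in> carrier_mat m 1" using e carr by (auto simp: u_def Lscale)
    have "ip u u = of_real (1 / sqrt x) * of_real (1 / sqrt x) * of_real x"
      using e carr by (simp add: u_def ip_scale_left ip_scale_right x)
    also have "\<dots> = of_real ((1 / sqrt x) * (1 / sqrt x) * x)" by (simp only: of_real_mult)
    also have "(1 / sqrt x) * (1 / sqrt x) * x = 1" using x by (simp add: field_simps)
    finally have uu: "ip u u = 1" by simp
    have u0: "ip u g = 0" "ip g u = 0" if "g \<in> L0" for g
    proof -
      have "g \<in> carrier_mat m 1" using that carr by (simp add: L0_def)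
      then show "ip u g = 0" using q that e carr by (simp add: u_def ip_scale_left e_def)
      then show "ip g u = 0" using ip_commute[of u g] uL \<open>g \<in> carrier_mat m 1\<close> by simp
    qed
    have \<phi>u: "\<phi> u \<noteq> 0" using e carr x by (simp add: u_def \<phi>_scale)
    have decomp: "\<exists>f0\<in>L0. \<exists>c. f = f0 + mon 0 c \<cdot>\<^sub>m u" if "f \<in> L" for f
    proof (intro bexI exI)
      let ?c = "\<phi> f / \<phi> u"
      show "f = (f + mon 0 (- ?c) \<cdot>\<^sub>m u) + mon 0 ?c \<cdot>\<^sub>m u"
        using carr[OF that] uL by (intro eq_matI) (auto simp: single_uminus)
      show "f + mon 0 (- ?c) \<cdot>\<^sub>m u \<in> L0"
        using that uL carr[OF that] \<phi>u by (simp add: L0_def Ladd Lscale \<phi>_add \<phi>_scale)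
    qed
    have c0: "g \<in> carrier_mat m 1" if "g \<in> L0" for g using that carr by (simp add: L0_def)
    have 1: "set (u # bs) \<subseteq> L" using bs uL by (auto simp: L0_def)
    have 2: "ip ((u # bs) ! a) ((u # bs) ! b) = (if a = b then 1 else 0)"
      if "a < length (u # bs)" "b < length (u # bs)" for a b
      using that on bs uu u0 by (cases a; cases b) (auto simp: subset_iff)
    have 3: "f = 0\<^sub>m m 1" if f: "f \<in> L" "\<And>b. b \<in> set (u # bs) \<Longrightarrow> ip f b = 0" for f
    proof -
      obtain f0 c where d: "f0 \<in> L0" "f = f0 + mon 0 c \<cdot>\<^sub>m u" using decomp f by blast
      have "ip f u = c" using d c0 uL uu u0 by (simp add: ip_add_left ip_scale_left)
      then have "c = 0" using f(2) by simp
      then have "f = f0" using d(2) c0[OF d(1)] uL by (intro eq_matI) auto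
      then have "f \<in> L0" using d by simp
      then show ?thesis using compl f(2) by simp
    qed
    have 4: "\<exists>l\<in>L. \<forall>g\<in>L. ip (f - l) g = 0" if f: "f \<in> carrier_mat m 1" for f
    proof -
      obtain l0 where l0: "l0 \<in> L0" "\<And>g. g \<in> L0 \<Longrightarrow> ip (f - l0) g = 0" using proj f by blast
      let ?l = "l0 + mon 0 (ip f u) \<cdot>\<^sub>m u"
      have "ip (f - ?l) g = 0" if g: "g \<in> L" for g
      proof -
        obtain g0 c where d: "g0 \<in> L0" "g = g0 + mon 0 c \<cdot>\<^sub>m u" using decomp g by blast
        have "ip f g0 = ip l0 g0" using l0(2)[OF d(1)] c0 d l0 f by (simp add: ip_diff_left)
        then show ?thesis
          using c0 d l0 f uL u0 uu
          by (simp add: ip_diff_left ip_add_left ip_add_right ip_scale_left ip_scale_right)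
      qed
      moreover have "?l \<in> L" using l0 uL by (simp add: L0_def Ladd Lscale)
      ultimately show ?thesis by blast
    qed
    show ?thesis using 1 2 3 4 by (intro exI[of _ "u # bs"] conjI allI ballI impI) blast+
  qed
qed
end

section \<open>A polynomial orthonormal frame for the range of a partial isometry\<close>

definition part_in :: "int set \<Rightarrow> laurent \<Rightarrow> laurent" where
  "part_in K f = Poly_Mapping.mapp (\<lambda>k c. if k \<in> K then c else 0) f"

lemma lookup_part_in [simp]: "coef (part_in K f) k = (if k \<in> K then coef f k else 0)"
  by (auto simp: part_in_def lookup_mapp when_def in_keys_iff)

lemma entries_in_part_in: "entries_in K (map_mat (part_in K) A)"
  by (auto simp: entries_in_def in_keys_iff split: if_splits)

lemma entries_inD: "entries_in K A \<Longrightarrow> i < dim_row A \<Longrightarrow> j < dim_col A \<Longrightarrow> k \<notin> K \<Longrightarrow> coef (A $$ (i, j)) k = 0"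
  unfolding entries_in_def by (metis in_keys_iff subsetD)

lemma entries_inI: "(\<And>i j k. i < dim_row A \<Longrightarrow> j < dim_col A \<Longrightarrow> k \<notin> K \<Longrightarrow> coef (A $$ (i, j)) k = 0) \<Longrightarrow> entries_in K A"
  unfolding entries_in_def by (auto simp: in_keys_iff)

lemma ip_disjoint_supports:
  assumes "f \<in> carrier_mat m 1" "g \<in> carrier_mat m 1"
    and "entries_in K f" "entries_in K' g" "K \<inter> K' = {}"
  shows "ip f g = 0"
proof -
  have "coef (lconj (g $$ (i, 0)) * f $$ (i, 0)) 0 = 0" if i: "i < m" for i
  proof -
    let ?a = "f $$ (i, 0)" and ?b = "g $$ (i, 0)"
    have s: "supp ?a \<subseteq> K" "supp ?b \<subseteq> K'" using assms i by (auto simp: entries_in_def)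
    have "0 \<notin> supp (lconj ?b * ?a)"
    proof
      assume "0 \<in> supp (lconj ?b * ?a)"
      then obtain k l where kl: "0 = k + l" "k \<in> supp (lconj ?b)" "l \<in> supp ?a"
        using keys_mult by blast
      then have "- k \<in> supp ?b" by (simp add: in_keys_iff)
      moreover have "- k = l" using kl(1) by simp
      ultimately show False using s kl(3) assms(5) by blast
    qed
    then show ?thesis by (simp add: in_keys_iff)
  qed
  then show ?thesis using assms by (simp add: ip_altdef)
qed

lemma mat_eq_minus_if_eq_add:
  fixes X :: "laurent mat"
  assumes "A = X + Y" "X \<in> carrier_mat n m" "Y \<in> carrier_mat n m"
  shows "X = A - Y"
  using assms by (intro eq_matI) auto

lemma ip_mult_right:
  assumes "A \<in> carrier_mat m n" "f \<in> carrier_mat n 1" "g \<in> carrier_mat m 1"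
  shows "ip g (A * f) = ip (adj A * g) f"
  using assms by (subst ip_mult_left[of "adj A" n m]) simp_all

lemma mon_smult_mon_smult: "mon k a \<cdot>\<^sub>m (mon l b \<cdot>\<^sub>m A) = mon (k + l) (a * b) \<cdot>\<^sub>m A"
  by (rule eq_matI) (auto simp: mult_single simp flip: mult.assoc)

lemma one_smult_laurent_mat [simp]: "1 \<cdot>\<^sub>m A = A" for A :: "laurent mat"
  by (rule eq_matI) auto

lemma entries_in_shift:
  assumes "entries_in K A" "\<And>k. k \<in> K \<Longrightarrow> k + n \<in> K'"
  shows "entries_in K' (mon n c \<cdot>\<^sub>m A)"
proof (rule entries_inI)
  fix i j k assume ij: "i < dim_row (mon n c \<cdot>\<^sub>m A)" "j < dim_col (mon n c \<cdot>\<^sub>m A)" and "k \<notin> K'"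
  then have "k - n \<notin> K" using assms(2)[of "k - n"] by auto
  then show "coef ((mon n c \<cdot>\<^sub>m A) $$ (i, j)) k = 0"
    using ij entries_inD[OF assms(1)] by (simp add: lookup_monomial_mult)
qed

lemma entries_in_Int: "entries_in K A \<Longrightarrow> entries_in K' A \<Longrightarrow> entries_in (K \<inter> K') A"
  unfolding entries_in_def by blast

lemma entries_bounded: "\<exists>n::nat. entries_in {..<int n} A"
proof -
  have "\<exists>n::nat. supp f \<subseteq> {..<int n}" for f
  proof -
    obtain N :: nat where "supp f \<subseteq> {- int N..int N}" by (rule supp_bounded)
    then have "supp f \<subseteq> {..<int (Suc N)}" by auto
    then show ?thesis by blast
  qed
  then obtain b :: "laurent \<Rightarrow> nat" where b: "\<And>f. supp f \<subseteq> {..<int (b f)}" by metis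
  define X where "X = (\<lambda>(i, j). b (A $$ (i, j))) ` ({..<dim_row A} \<times> {..<dim_col A})"
  have "finite X" unfolding X_def by simp
  have "entries_in {..<int (Max (insert 0 X))} A"
    unfolding entries_in_def
  proof (intro allI impI)
    fix i j assume "i < dim_row A" "j < dim_col A"
    then have "b (A $$ (i, j)) \<in> X" unfolding X_def by force
    then have "b (A $$ (i, j)) \<le> Max (insert 0 X)" using \<open>finite X\<close> by simp
    then show "supp (A $$ (i, j)) \<subseteq> {..<int (Max (insert 0 X))}"
      using b[of "A $$ (i, j)"] by force
  qed
  then show ?thesis by blast
qed

definition colm :: "'a mat \<Rightarrow> nat \<Rightarrow> 'a mat" where
  "colm A j = mat (dim_row A) 1 (\<lambda>(i, _). A $$ (i, j))"

lemma colm_carrier [simp, simplified, simp]: "A \<in> carrier_mat n m \<Longrightarrow> colm A j \<in> carrier_mat n 1"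
  by (auto simp: colm_def)

lemma dim_colm [simp]: "dim_row (colm A j) = dim_row A" "dim_col (colm A j) = 1"
  by (auto simp: colm_def)

lemma index_colm [simp]: "i < dim_row A \<Longrightarrow> colm A j $$ (i, 0) = A $$ (i, j)"
  by (simp add: colm_def)

lemma colm_mult:
  assumes "A \<in> carrier_mat n k" "B \<in> carrier_mat k m" "j < m"
  shows "colm (A * B) j = A * colm B j"
  using assms by (intro eq_matI) (auto simp: scalar_prod_def colm_def)

lemma eq_mat_colmI:
  assumes "A \<in> carrier_mat n m" "B \<in> carrier_mat n m" "\<And>j. j < m \<Longrightarrow> colm A j = colm B j"
  shows "A = B"
proof (rule eq_matI)
  fix i j assume "i < dim_row B" "j < dim_col B"
  then show "A $$ (i, j) = B $$ (i, j)"
    using assms index_colm[of i A j] index_colm[of i B j] by auto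
qed (use assms in auto)

lemma entries_in_colm: "entries_in K A \<Longrightarrow> j < dim_col A \<Longrightarrow> entries_in K (colm A j)"
  by (auto simp: entries_in_def)

text \<open>
  All coefficients of a product \<open>A\<^sup>* F\<close>, not only the constant ones, are inner products of columns
  once a column of \<open>F\<close> is shifted by a power of \<open>z\<close>.
\<close>

lemma coef_gram:
  assumes "A \<in> carrier_mat m a" "F \<in> carrier_mat m b" "i < a" "j < b"
  shows "coef ((adj A * F) $$ (i, j)) k = ip (mon (- k) 1 \<cdot>\<^sub>m colm F j) (colm A i)"
proof -
  have "ip (mon (- k) 1 \<cdot>\<^sub>m colm F j) (colm A i) =
      (\<Sum>l<m. coef (lconj (A $$ (l, i)) * (mon (- k) 1 * F $$ (l, j))) 0)"
    using assms by (subst ip_altdef[of _ m]) (auto intro!: sum.cong simp: colm_def)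
  also have "\<dots> = (\<Sum>l<m. coef (lconj (A $$ (l, i)) * F $$ (l, j)) k)"
    by (simp add: lookup_monomial_mult mult.left_commute[of _ "mon (- k) 1"])
  also have "\<dots> = coef ((adj A * F) $$ (i, j)) k"
    using assms by (simp add: scalar_prod_def lookup_sum lessThan_atLeast0)
  finally show ?thesis by simp
qed

text \<open>
  The hypothesis says that \<open>H\<close> is a partial isometry on the circle, so that \<open>H H\<^sup>*\<close> is the projection onto
  its range.  The columns of \<open>V\<close> span the wandering subspace \<open>W = M \<ominus> z M\<close>, where \<open>M\<close> (below
  \<open>M {0..}\<close>; then \<open>z M\<close> is \<open>M {1..}\<close>, since \<open>f / z\<close> has values in the same ranges) consists of the
  polynomial columns with values in the range of \<open>H\<close>.  Orthogonality of \<open>W\<close> to \<open>z M\<close> says both that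
  \<open>V\<^sup>* V\<close> has no nonconstant coefficients and that \<open>V\<^sup>* f\<close> has no negative exponents
  for \<open>f \<in> M\<close>.  Every \<open>f \<in> M\<close> is a combination of the columns of \<open>V\<close> with polynomial
  coefficients, because a remainder \<open>g\<close> with \<open>V\<^sup>* g = 0\<close> is divisible by \<open>z\<close> arbitrarily often.
\<close>

lemma isometric_polynomial_frame:
  assumes H: "H \<in> carrier_mat m p" and Hd: "entries_in {0..d} H" and HHH: "H * (adj H * H) = H"
  obtains r V where "V \<in> carrier_mat m r" "entries_in {0..} V"
    "adj V * V = 1\<^sub>m r" "V * adj V = H * adj H"
    "\<And>F q. F \<in> carrier_mat m q \<Longrightarrow> entries_in {0..} F \<Longrightarrow> H * (adj H * F) = F \<Longrightarrow>
       entries_in {0..} (adj V * F)"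
proof -
  define M where "M K = {f \<in> carrier_mat m 1. H * (adj H * f) = f \<and> entries_in K f}" for K
  have aH: "adj H \<in> carrier_mat p m" using H by simp
  have Mc: "f \<in> carrier_mat m 1" if "f \<in> M K" for f K using that by (simp add: M_def)
  have Mmono: "f \<in> M K'" if "f \<in> M K" "K \<subseteq> K'" for f K K'
    using that entries_in_mono by (auto simp: M_def)
  have MInt: "f \<in> M (K \<inter> K')" if "f \<in> M K" "f \<in> M K'" for f K K'
    using that entries_in_Int by (auto simp: M_def)
  have Madd: "f + g \<in> M K" if "f \<in> M K" "g \<in> M K" for f g K
  proof -
    have fg: "f \<in> carrier_mat m 1" "g \<in> carrier_mat m 1" using that by (auto simp: M_def)
    have "H * (adj H * (f + g)) = H * (adj H * f) + H * (adj H * g)"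
      by (simp only: mult_add_distrib_mat[OF aH fg]
          mult_add_distrib_mat[OF H mult_carrier_mat[OF aH fg(1)] mult_carrier_mat[OF aH fg(2)]])
    then show ?thesis using that fg entries_in_add[of K f g m 1] by (simp add: M_def)
  qed
  have Mdiff: "f - g \<in> M K" if "f \<in> M K" "g \<in> M K" for f g K
  proof -
    have fg: "f \<in> carrier_mat m 1" "g \<in> carrier_mat m 1" using that by (auto simp: M_def)
    have "H * (adj H * (f - g)) = H * (adj H * f) - H * (adj H * g)"
      by (simp only: mult_minus_distrib_mat[OF aH fg]
          mult_minus_distrib_mat[OF H mult_carrier_mat[OF aH fg(1)] mult_carrier_mat[OF aH fg(2)]])
    then show ?thesis using that fg entries_in_minus[of K f g m 1] by (simp add: M_def minus_carrier_mat)
  qed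
  have Mshift: "mon n c \<cdot>\<^sub>m f \<in> M K'" if "f \<in> M K" "\<And>k. k \<in> K \<Longrightarrow> k + n \<in> K'" for f n c K K'
  proof -
    have f: "f \<in> carrier_mat m 1" using that by (auto simp: M_def)
    have "H * (adj H * (mon n c \<cdot>\<^sub>m f)) = mon n c \<cdot>\<^sub>m (H * (adj H * f))"
      by (simp only: mult_smult_distrib[OF aH f] mult_smult_distrib[OF H mult_carrier_mat[OF aH f]])
    then show ?thesis using that f entries_in_shift[of K f n K' c] by (simp add: M_def)
  qed
  have Msub: "is_subspace m (M K)" for K
    unfolding is_subspace_def
  proof (intro conjI ballI allI)
    show "0\<^sub>m m 1 \<in> M K" using H aH by (simp add: M_def)
  qed (use Mc Madd Mshift[of _ K 0 K] in auto)
  have MH: "H * x \<in> M K" if "x \<in> carrier_mat p 1" "entries_in K (H * x)" for x K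
  proof -
    have "H * (adj H * (H * x)) = H * (adj H * H) * x"
      by (simp only: assoc_mult_mat[OF aH H that(1)] assoc_mult_mat[OF H mult_carrier_mat[OF aH H] that(1)])
    then show ?thesis using that H HHH by (simp add: M_def)
  qed
  \<comment> \<open>The basic decomposition: modulo \<open>z M\<close> an element of \<open>M\<close> is \<open>H a\<close>, whose exponents
     are bounded above by those of \<open>H\<close>.\<close>
  have split: "\<exists>a b. a \<in> carrier_mat p 1 \<and> b \<in> carrier_mat p 1 \<and> entries_in {..0} a \<and>
      entries_in {1..} b \<and> adj H * f = a + b \<and> f = H * a + H * b \<and>
      H * a \<in> M {0..d} \<and> H * b \<in> M {1..}" if f: "f \<in> M {0..}" for f
  proof (intro exI conjI)
    let ?x = "adj H * f"
    let ?a = "map_mat (part_in {..0}) ?x" and ?b = "map_mat (part_in {1..}) ?x"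
    have x: "?x \<in> carrier_mat p 1" using aH Mc[OF f] by simp
    show a: "?a \<in> carrier_mat p 1" and b: "?b \<in> carrier_mat p 1" using x by auto
    show ea: "entries_in {..0} ?a" and eb: "entries_in {1..} ?b" by (rule entries_in_part_in)+
    show ab: "?x = ?a + ?b"
      by (intro eq_matI poly_mapping_eqI) (auto simp: lookup_add)
    show sum: "f = H * ?a + H * ?b"
      using f ab mult_add_distrib_mat[OF H a b] by (simp add: M_def)
    show Hb: "H * ?b \<in> M {1..}"
      by (intro MH b entries_in_mult[OF Hd eb H b]) auto
    have "H * ?a = f - H * ?b"
      by (rule mat_eq_minus_if_eq_add[OF sum mult_carrier_mat[OF H a] mult_carrier_mat[OF H b]])
    then have "H * ?a \<in> M {0..}"
      using Mdiff[OF f Mmono[OF Hb]] by auto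
    moreover have "H * ?a \<in> M {..d}"
      by (intro MH a entries_in_mult[OF Hd ea H a]) auto
    ultimately have "H * ?a \<in> M ({0..} \<inter> {..d})" by (rule MInt)
    then show "H * ?a \<in> M {0..d}" by (rule Mmono) auto
  qed
  \<comment> \<open>Orthogonality is only imposed against \<open>z M\<close> in degrees up to \<open>d\<close>, which keeps
     everything finite-dimensional; the next step shows that it holds against all of \<open>z M\<close>.\<close>
  define W where "W = {w \<in> M {0..d}. \<forall>g \<in> M {1..d}. ip w g = 0}"
  have WM: "w \<in> M {0..}" if "w \<in> W" for w
    using that Mmono[of w "{0..d}" "{0..}"] by (auto simp: W_def)
  have Wc: "w \<in> carrier_mat m 1" if "w \<in> W" for w using WM[OF that] by (rule Mc)
  have wandering: "ip w g = 0" if w: "w \<in> W" and g: "g \<in> M {1..}" for w g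
  proof -
    obtain a b where ab: "a \<in> carrier_mat p 1" "b \<in> carrier_mat p 1" "entries_in {..0} a"
      "entries_in {1..} b" "adj H * w = a + b" "w = H * a + H * b" "H * a \<in> M {0..d}" "H * b \<in> M {1..}"
      using split[OF WM[OF w]] by blast
    have Ha: "H * a \<in> carrier_mat m 1" and Hb: "H * b \<in> carrier_mat m 1" using H ab by auto
    have "H * b = w - H * a"
      using ab(6) Ha Hb by (intro mat_eq_minus_if_eq_add) (auto simp: comm_add_mat)
    then have "H * b \<in> M {0..d}"
      using w Mdiff[OF _ ab(7)] by (simp add: W_def)
    \<comment> \<open>So \<open>w\<close> is orthogonal to \<open>H b\<close>, and \<open>\<langle>w, H b\<rangle> = \<langle>a + b, b\<rangle> = \<langle>b, b\<rangle>\<close>: the part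
       of \<open>H\<^sup>* w\<close> with positive exponents vanishes.\<close>
    from MInt[OF this ab(8)] have "H * b \<in> M {1..d}" by (rule Mmono) auto
    then have "ip w (H * b) = 0" using w by (simp add: W_def)
    then have "ip (a + b) b = 0"
      using ip_mult_right[OF H ab(2) Wc[OF w]] ab(5) by simp
    moreover have "ip a b = 0" by (rule ip_disjoint_supports[OF ab(1,2,3,4)]) auto
    ultimately have "ip b b = 0" using ip_add_left[OF ab(1,2,2)] by simp
    then have "b = 0\<^sub>m p 1" using ip_self_eq_zeroD ab(2) by blast
    then have Hw: "adj H * w = a" using ab(1,5) by simp
    obtain a' b' where ab': "a' \<in> carrier_mat p 1" "b' \<in> carrier_mat p 1" "entries_in {..0} a'"
      "entries_in {1..} b'" "g = H * a' + H * b'" "H * a' \<in> M {0..d}" "H * b' \<in> M {1..}"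
      using split[OF Mmono[OF g]] by auto
    have Ha': "H * a' \<in> carrier_mat m 1" and Hb': "H * b' \<in> carrier_mat m 1" using H ab' by auto
    have "H * a' = g - H * b'"
      by (rule mat_eq_minus_if_eq_add[OF ab'(5) Ha' Hb'])
    then have "H * a' \<in> M {1..}" using Mdiff[OF g ab'(7)] by simp
    from MInt[OF ab'(6) this] have "H * a' \<in> M {1..d}" by (rule Mmono) auto
    then have "ip w (H * a') = 0" using w by (simp add: W_def)
    moreover have "ip w (H * b') = 0"
      using ip_mult_right[OF H ab'(2) Wc[OF w]] Hw
        ip_disjoint_supports[OF ab(1) ab'(2) ab(3) ab'(4)] by (simp add: disjoint_iff)
    ultimately show ?thesis
      using ip_add_right[OF Ha' Hb' Wc[OF w]] ab'(5) by simp
  qed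
  have fin: "finite ({..<m} \<times> {0..d})" by simp
  have sep: "f = 0\<^sub>m m 1" if "f \<in> M K" "K \<subseteq> {0..d}" "\<And>i k. (i, k) \<in> {..<m} \<times> {0..d} \<Longrightarrow> coef (f $$ (i, 0)) k = 0" for f K
  proof (intro eq_matI poly_mapping_eqI)
    fix i j k assume ij: "i < dim_row (0\<^sub>m m 1 :: laurent mat)" "j < dim_col (0\<^sub>m m 1 :: laurent mat)"
    have "coef (f $$ (i, 0)) k = 0"
    proof (cases "k \<in> {0..d}")
      case False
      then have "k \<notin> K" using that(2) by blast
      then show ?thesis using that(1) ij by (intro entries_inD[of K f]) (auto simp: M_def)
    qed (use that ij in auto)
    then show "coef (f $$ (i, j)) k = coef (0\<^sub>m m 1 $$ (i, j)) k" using ij by simp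
  qed (use that in \<open>auto simp: M_def\<close>)
  have "\<exists>bs. set bs \<subseteq> M {1..d} \<and>
           (\<forall>i<length bs. \<forall>j<length bs. ip (bs ! i) (bs ! j) = (if i = j then 1 else 0)) \<and>
           (\<forall>f\<in>M {1..d}. (\<forall>b\<in>set bs. ip f b = 0) \<longrightarrow> f = 0\<^sub>m m 1) \<and>
           (\<forall>f\<in>carrier_mat m 1. \<exists>l\<in>M {1..d}. \<forall>g\<in>M {1..d}. ip (f - l) g = 0)"
    by (rule orthonormal_basis_and_projection[OF fin _ Msub])
      (use sep[of _ "{1..d}"] in \<open>auto simp: subset_iff\<close>)
  then have proj: "\<exists>l\<in>M {1..d}. \<forall>g\<in>M {1..d}. ip (f - l) g = 0" if "f \<in> carrier_mat m 1" for f
    using that by (elim exE conjE) (rule bspec)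
  have decomp: "\<exists>w\<in>W. \<exists>g\<in>M {1..}. f = w + g" if f: "f \<in> M {0..}" for f
  proof -
    obtain a b where ab: "a \<in> carrier_mat p 1" "b \<in> carrier_mat p 1"
      "f = H * a + H * b" "H * a \<in> M {0..d}" "H * b \<in> M {1..}"
      using split[OF f] by blast
    obtain l where l: "l \<in> M {1..d}" "\<And>g. g \<in> M {1..d} \<Longrightarrow> ip (H * a - l) g = 0"
      using proj[OF Mc[OF ab(4)]] by blast
    have "H * a - l \<in> W"
      using Mdiff[OF ab(4) Mmono[OF l(1)]] l(2) by (auto simp: W_def)
    moreover have "l + H * b \<in> M {1..}"
      using Madd[OF Mmono[OF l(1)] ab(5)] by auto
    moreover have "f = (H * a - l) + (l + H * b)"
    proof -
      have regroup: "x + y = (x - z) + (z + y)" if "x \<in> carrier_mat m 1" "y \<in> carrier_mat m 1" "z \<in> carrier_mat m 1"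
        for x y z :: "laurent mat"
        using that by (intro eq_matI) auto
      show ?thesis
        by (rule trans[OF ab(3) regroup[OF Mc[OF ab(4)] Mc[OF ab(5)] Mc[OF l(1)]]])
    qed
    ultimately show ?thesis by blast
  qed
  have Wsub: "is_subspace m W"
    unfolding is_subspace_def
  proof (intro conjI ballI allI)
    show "W \<subseteq> carrier_mat m 1" using Wc by blast
    show "0\<^sub>m m 1 \<in> W"
      using Msub[of "{0..d}"] Mc ip_zero_left by (auto simp: W_def is_subspace_def)
    show "f + g \<in> W" if "f \<in> W" "g \<in> W" for f g
      using that Madd ip_add_left[of f m g] Mc[of _ "{1..d}"] Wc[OF that(1)] Wc[OF that(2)]
      by (simp add: W_def)
    show "mon 0 c \<cdot>\<^sub>m f \<in> W" if "f \<in> W" for c f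
      using that Mshift[of f "{0..d}" 0 "{0..d}" c] ip_scale_left[of f m] Mc[of _ "{1..d}"] Wc[OF that]
      by (simp add: W_def)
  qed
  have "\<exists>bs. set bs \<subseteq> W \<and>
           (\<forall>i<length bs. \<forall>j<length bs. ip (bs ! i) (bs ! j) = (if i = j then 1 else 0)) \<and>
           (\<forall>f\<in>W. (\<forall>b\<in>set bs. ip f b = 0) \<longrightarrow> f = 0\<^sub>m m 1) \<and>
           (\<forall>f\<in>carrier_mat m 1. \<exists>l\<in>W. \<forall>g\<in>W. ip (f - l) g = 0)"
    by (rule orthonormal_basis_and_projection[OF fin _ Wsub])
      (use sep[of _ "{0..d}"] in \<open>auto simp: W_def\<close>)
  then obtain bs where bs: "set bs \<subseteq> W"
    and on: "\<forall>i<length bs. \<forall>j<length bs. ip (bs ! i) (bs ! j) = (if i = j then 1 else 0)"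
    and compl: "\<forall>f\<in>W. (\<forall>b\<in>set bs. ip f b = 0) \<longrightarrow> f = 0\<^sub>m m 1"
    by (elim exE conjE)
  define r where "r = length bs"
  define V where "V = mat m r (\<lambda>(i, j). (bs ! j) $$ (i, 0))"
  have V: "V \<in> carrier_mat m r" by (simp add: V_def)
  then have aV: "adj V \<in> carrier_mat r m" by simp
  have bsW: "bs ! j \<in> W" if "j < r" for j using bs that by (auto simp: r_def)
  have colV: "colm V j = bs ! j" if "j < r" for j
    using Wc[OF bsW[OF that]] that by (intro eq_matI) (auto simp: V_def colm_def)
  have analytic: "entries_in {0..} (adj V * F)"
    if F: "F \<in> carrier_mat m q" "entries_in {0..} F" "H * (adj H * F) = F" for F q
  proof (rule entries_inI)
    fix i j and k :: int assume ij: "i < dim_row (adj V * F)" "j < dim_col (adj V * F)" and k: "k \<notin> {0..}"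
    then have i: "i < r" and j: "j < q" using V F by auto
    have "colm F j \<in> M {0..}"
      using F j colm_mult[OF H mult_carrier_mat[OF aH F(1)] j] colm_mult[OF aH F(1) j]
      by (simp add: M_def entries_in_colm)
    then have "mon (- k) 1 \<cdot>\<^sub>m colm F j \<in> M {1..}" by (rule Mshift) (use k in auto)
    then have "ip (bs ! i) (mon (- k) 1 \<cdot>\<^sub>m colm F j) = 0" using wandering bsW i by blast
    then have "ip (mon (- k) 1 \<cdot>\<^sub>m colm F j) (bs ! i) = 0"
      using ip_commute[of "bs ! i" m "mon (- k) 1 \<cdot>\<^sub>m colm F j"] Wc[OF bsW[OF i]] F by simp
    then show "coef ((adj V * F) $$ (i, j)) k = 0"
      using coef_gram[OF V F(1) i j] colV[OF i] by simp
  qed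
  have Vent: "entries_in {0..} V"
    unfolding entries_in_def
  proof (intro allI impI)
    fix i j assume "i < dim_row V" "j < dim_col V"
    then have ij: "i < m" "j < r" using V by auto
    have "entries_in {0..} (bs ! j)" "bs ! j \<in> carrier_mat m 1"
      using WM[OF bsW[OF ij(2)]] by (simp_all add: M_def)
    then show "supp (V $$ (i, j)) \<subseteq> {0..}"
      using ij unfolding entries_in_def by (simp add: V_def)
  qed
  have HHV: "H * (adj H * V) = V"
  proof (rule eq_mat_colmI[OF _ V])
    fix j assume j: "j < r"
    show "colm (H * (adj H * V)) j = colm V j"
      using colm_mult[OF H mult_carrier_mat[OF aH V] j] colm_mult[OF aH V j] colV[OF j] WM[OF bsW[OF j]]
      by (simp add: M_def)
  qed (use H aH V in auto)
  have VV: "adj V * V = 1\<^sub>m r"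
  proof (rule eq_matI)
    fix i j assume "i < dim_row (1\<^sub>m r :: laurent mat)" "j < dim_col (1\<^sub>m r :: laurent mat)"
    then have i: "i < r" and j: "j < r" by auto
    \<comment> \<open>Negative exponents are excluded by \<open>analytic\<close>, positive ones by self-adjointness.\<close>
    have neg: "coef ((adj V * V) $$ (i, j)) k = 0" if "k < 0" "i < r" "j < r" for i j and k :: int
      using analytic[OF V Vent HHV] that V entries_inD[of "{0..}" "adj V * V" i j k] by auto
    have sym: "coef ((adj V * V) $$ (i, j)) k = cnj (coef ((adj V * V) $$ (j, i)) (- k))" for k
    proof -
      have "adj (adj V * V) = adj V * V" using adj_mult[OF aH, of V] adj_mult[OF aV V] by simp
      then have "(adj V * V) $$ (i, j) = adj (adj V * V) $$ (i, j)" by simp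
      also have "\<dots> = lconj ((adj V * V) $$ (j, i))" using i j V by (intro index_adj) auto
      finally show ?thesis by simp
    qed
    show "(adj V * V) $$ (i, j) = 1\<^sub>m r $$ (i, j)"
    proof (rule poly_mapping_eqI)
      fix k :: int
      consider "k < 0" | "k > 0" | "k = 0" by linarith
      then show "coef ((adj V * V) $$ (i, j)) k = coef (1\<^sub>m r $$ (i, j)) k"
      proof cases
        case 1
        then show ?thesis using neg i j by (simp add: lookup_one)
      next
        case 2
        then show ?thesis using neg[of "- k" j i] sym[of k] i j by (simp add: lookup_one)
      next
        case 3
        then show ?thesis
          using coef_gram[OF V V i j, of 0] on i j colV by (simp add: r_def)
      qed
    qed
  qed (use V in auto)
  \<comment> \<open>In \<open>g = w + h\<close> with \<open>h \<in> z M\<close>, the numbers \<open>\<langle>w, b\<rangle>\<close> are the constant coefficients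
     of \<open>V\<^sup>* g\<close>, so \<open>w = 0\<close>.\<close>
  have vanish: "g \<in> M {1..}" if g: "g \<in> M {0..}" and Vg: "adj V * g = 0\<^sub>m r 1" for g
  proof -
    obtain w h where wh: "w \<in> W" "h \<in> M {1..}" "g = w + h" using decomp[OF g] by blast
    have "ip w b = 0" if b: "b \<in> set bs" for b
    proof -
      obtain i where i: "i < r" "b = bs ! i" using b by (auto simp: in_set_conv_nth r_def)
      have gc: "colm g 0 = g" using Mc[OF g] by (intro eq_matI) (auto simp: colm_def)
      have "coef ((adj V * g) $$ (i, 0)) 0 = ip g b"
        using coef_gram[OF V Mc[OF g] i(1), of 0 0] colV[OF i(1)] i gc by simp
      then have "ip g b = 0" using Vg i by simp
      moreover have "ip h b = 0"
        using wandering[OF bsW[OF i(1)] wh(2)] i ip_commute[of b m h] Wc[OF bsW[OF i(1)]] Mc[OF wh(2)] by simp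
      ultimately show ?thesis
        using ip_add_left[OF Wc[OF wh(1)] Mc[OF wh(2)] Wc[OF bsW[OF i(1)]]] wh(3) i by simp
    qed
    then have "w = 0\<^sub>m m 1" using compl wh(1) by blast
    then show ?thesis using wh Mc[OF wh(2)] by simp
  qed
  have descent: "g = 0\<^sub>m m 1" if "g \<in> M {0..<int n}" "adj V * g = 0\<^sub>m r 1" for g n
    using that
  proof (induction n arbitrary: g)
    case 0
    then have "entries_in {} g" by (simp add: M_def)
    then show ?case
      using Mc[OF 0(1)] by (intro eq_matI) (auto simp: entries_in_def)
  next
    case (Suc n)
    have gc: "g \<in> carrier_mat m 1" by (rule Mc[OF Suc.prems(1)])
    have "g \<in> M {1..}" by (rule vanish[OF Mmono[OF Suc.prems(1)] Suc.prems(2)]) auto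
    from MInt[OF this Suc.prems(1)] have "g \<in> M {1..int n}" by (rule Mmono) auto
    then have "mon (- 1) 1 \<cdot>\<^sub>m g \<in> M {0..<int n}" by (rule Mshift) auto
    moreover have "adj V * (mon (- 1) 1 \<cdot>\<^sub>m g) = 0\<^sub>m r 1"
      using mult_smult_distrib[OF aV gc] Suc.prems(2) by simp
    ultimately have "mon (- 1) 1 \<cdot>\<^sub>m g = 0\<^sub>m m 1" by (rule Suc.IH)
    then have "mon 1 1 \<cdot>\<^sub>m (mon (- 1) 1 \<cdot>\<^sub>m g) = 0\<^sub>m m 1" by simp
    then show ?case by (simp add: mon_smult_mon_smult)
  qed
  have VVH: "V * (adj V * H) = H"
  proof (rule eq_mat_colmI[OF _ H])
    fix j assume j: "j < p"
    define h where "h = colm H j"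
    have h: "h \<in> carrier_mat m 1" using H by (simp add: h_def)
    have hM: "h \<in> M {0..}"
      using colm_mult[OF H mult_carrier_mat[OF aH H] j] colm_mult[OF aH H j] HHH h
        entries_in_mono[OF entries_in_colm[OF Hd]] H j
      by (auto simp: M_def h_def)
    have Vh: "adj V * h \<in> carrier_mat r 1" using aV h by simp
    have VVh: "V * (adj V * h) \<in> M {0..}"
    proof -
      have "entries_in {0..} (adj V * h)" using analytic[OF h] hM by (simp add: M_def)
      then have "entries_in {0..} (V * (adj V * h))"
        by (rule entries_in_mult[OF Vent _ V Vh]) auto
      moreover have "H * (adj H * (V * (adj V * h))) = H * (adj H * V) * (adj V * h)"
        by (simp only: assoc_mult_mat[OF aH V Vh] assoc_mult_mat[OF H mult_carrier_mat[OF aH V] Vh])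
      ultimately show ?thesis using V Vh HHV by (simp add: M_def)
    qed
    define g where "g = h - V * (adj V * h)"
    have gM: "g \<in> M {0..}" unfolding g_def by (rule Mdiff[OF hM VVh])
    have "adj V * g = adj V * h - adj V * (V * (adj V * h))"
      unfolding g_def using mult_minus_distrib_mat[OF aV h Mc[OF VVh]] .
    also have "adj V * (V * (adj V * h)) = (adj V * V) * (adj V * h)"
      by (rule assoc_mult_mat[OF aV V Vh, symmetric])
    also have "\<dots> = adj V * h" by (simp only: VV left_mult_one_mat[OF Vh])
    finally have Vg: "adj V * g = 0\<^sub>m r 1" by (simp only: minus_r_inv_mat[OF Vh])
    obtain n where "entries_in {..<int n} g" using entries_bounded by blast
    then have "g \<in> M ({0..} \<inter> {..<int n})" using gM entries_in_Int by (auto simp: M_def)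
    then have "g \<in> M {0..<int n}" by (rule Mmono) auto
    then have "g = 0\<^sub>m m 1" using descent Vg by blast
    have "h = g + V * (adj V * h)"
      unfolding g_def using h Mc[OF VVh] by (intro eq_matI) auto
    then have "h = V * (adj V * h)" using \<open>g = 0\<^sub>m m 1\<close> Mc[OF VVh] by simp
    then show "colm (V * (adj V * H)) j = colm H j"
      using colm_mult[OF V mult_carrier_mat[OF aV H] j] colm_mult[OF aV H j] by (simp add: h_def)
  qed (use H V aV in auto)
  have "V * adj V = H * adj H"
  proof -
    have "adj V * (H * adj H) = adj (H * (adj H * V))"
      by (simp only: adj_mult[OF H mult_carrier_mat[OF aH V]] adj_mult[OF aH V] adj_adj
          assoc_mult_mat[OF aV H aH])
    also have "\<dots> = adj V" by (simp add: HHV)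
    finally have "V * adj V = V * (adj V * (H * adj H))" by simp
    also have "\<dots> = (V * (adj V * H)) * adj H"
      by (simp only: assoc_mult_mat[OF aV H aH] assoc_mult_mat[OF V mult_carrier_mat[OF aV H] aH])
    finally show ?thesis by (simp add: VVH)
  qed
  then show ?thesis using that V Vent VV analytic by blast
qed

section \<open>Compressing a colligation to the frame\<close>

text \<open>
  Matrix laws with side conditions on dimensions: unlike carrier conditions, these contain no variables
  beyond those of the equation, so the simplifier can use the laws to put products into
  right-associated normal form.
\<close>

lemma mult_assoc_dim:
  fixes A B C :: "'a::semiring_0 mat"
  assumes "dim_col A = dim_row B" "dim_col B = dim_row C"
  shows "A * B * C = A * (B * C)"
  using assms by (intro assoc_mult_mat[of A "dim_row A" "dim_row B" B "dim_row C" C "dim_col C"]) auto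

lemma mult_add_dim:
  fixes A B C :: "'a::semiring_0 mat"
  assumes "dim_col A = dim_row B" "dim_row B = dim_row C" "dim_col B = dim_col C"
  shows "A * (B + C) = A * B + A * C"
  using assms by (intro mult_add_distrib_mat[of A "dim_row A" "dim_row B" B "dim_col B"]) auto

lemma add_mult_dim:
  fixes A B C :: "'a::semiring_0 mat"
  assumes "dim_col B = dim_row A" "dim_row B = dim_row C" "dim_col B = dim_col C"
  shows "(B + C) * A = B * A + C * A"
  using assms by (intro add_mult_distrib_mat[of B "dim_row B" "dim_row A" C A "dim_col A"]) auto

lemma one_mult_dim: "dim_row A = n \<Longrightarrow> 1\<^sub>m n * A = A" for A :: "'a::semiring_1 mat"
  by (rule left_mult_one_mat[of A n "dim_col A"]) auto

lemma mult_one_dim: "dim_col A = n \<Longrightarrow> A * 1\<^sub>m n = A" for A :: "'a::semiring_1 mat"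
  by (rule right_mult_one_mat[of A "dim_row A" n]) auto

lemma zero_mult_dim: "dim_row A = n \<Longrightarrow> 0\<^sub>m k n * A = 0\<^sub>m k (dim_col A)" for A :: "'a::semiring_0 mat"
  by (rule left_mult_zero_mat[of A n "dim_col A"]) auto

lemma mult_zero_dim: "dim_col A = n \<Longrightarrow> A * 0\<^sub>m n k = 0\<^sub>m (dim_row A) k" for A :: "'a::semiring_0 mat"
  by (rule right_mult_zero_mat[of A "dim_row A" n]) auto

lemma adj_mult_dim: "dim_col A = dim_row B \<Longrightarrow> adj (A * B) = adj B * adj A"
  by (rule adj_mult[of A "dim_row A" "dim_row B" B "dim_col B"]) auto

lemma adj_add_dim: "dim_row A = dim_row B \<Longrightarrow> dim_col A = dim_col B \<Longrightarrow> adj (A + B) = adj A + adj B"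
  by (rule adj_add[of A "dim_row A" "dim_col A" B]) auto

lemma dim_pow_mat: "dim_row A = n \<Longrightarrow> dim_col A = n \<Longrightarrow> dim_row (A ^\<^sub>m k) = n \<and> dim_col (A ^\<^sub>m k) = n"
  using pow_carrier_mat[of A n k] by auto

lemmas mat_alg = mult_assoc_dim mult_add_dim add_mult_dim one_mult_dim mult_one_dim
  zero_mult_dim mult_zero_dim adj_mult_dim adj_add_dim dim_pow_mat

lemma adj_four_block:
  assumes "A \<in> carrier_mat n n" "B \<in> carrier_mat n r" "C \<in> carrier_mat r n" "D \<in> carrier_mat r r"
  shows "adj (four_block_mat A B C D) = four_block_mat (adj A) (adj C) (adj B) (adj D)"
  using assms by (intro eq_matI) (auto simp: index_mat_four_block)

text \<open>
  The colligation \<open>(S0 P; H P\<^sup>* Z)\<close> is isometric once its state is restricted to the range of \<open>H\<close>: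
  the diagonal blocks of its Gram matrix are identities, the lower left block is \<open>T P\<^sup>*\<close>, and
  \<open>T\<^sup>*\<close> annihilates that range.  The range is invariant under
  \<open>Z\<close> by \<open>ZH\<close>.  Compressing by the frame \<open>V\<close> of the range therefore yields an isometry without
  changing the products \<open>P Z\<^sup>k H P\<^sup>*\<close>, that is, the coefficients of the function realized.
\<close>

lemma compress_colligation:
  assumes S0: "S0 \<in> carrier_mat N N" and P: "P \<in> carrier_mat N m" and Z: "Z \<in> carrier_mat m m"
    and H: "H \<in> carrier_mat m m" and T: "T \<in> carrier_mat m m"
    and HT: "H * adj H + T * adj T = 1\<^sub>m m" and TH: "adj T * H = 0\<^sub>m m m"
    and ZH: "Z * H = H * adj Z"
    and PZ: "adj P * P + adj Z * Z = 1\<^sub>m m"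
    and first: "adj S0 * S0 + adj (H * adj P) * (H * adj P) = 1\<^sub>m N"
    and cross: "adj P * S0 + adj Z * (H * adj P) = T * adj P"
    and ent: "entries_in {0..d} H" "entries_in {0} P" "entries_in {0} Z"
  obtains r B C D where "B \<in> carrier_mat N r" "C \<in> carrier_mat r N" "D \<in> carrier_mat r r"
    "adj (four_block_mat S0 B C D) * four_block_mat S0 B C D = 1\<^sub>m (N + r)"
    "entries_in {0..} B" "entries_in {0..} C" "entries_in {0..} D"
    "\<And>k. B * (D ^\<^sub>m k * C) = P * (Z ^\<^sub>m k * (H * adj P))"
    "\<And>k. Z ^\<^sub>m k = 0\<^sub>m m m \<Longrightarrow> D ^\<^sub>m k = 0\<^sub>m r r"
proof -
  have d [simp]: "dim_row S0 = N" "dim_col S0 = N" "dim_row P = N" "dim_col P = m"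
    "dim_row Z = m" "dim_col Z = m" "dim_row H = m" "dim_col H = m" "dim_row T = m" "dim_col T = m"
    using S0 P Z H T by auto
  have "H = (H * adj H + T * adj T) * H" by (simp add: HT mat_alg)
  also have "\<dots> = H * (adj H * H) + T * (adj T * H)" by (simp add: mat_alg)
  also have "\<dots> = H * (adj H * H)" by (simp add: TH mat_alg) (intro eq_matI, auto)
  finally have HHH: "H * (adj H * H) = H" by simp
  obtain r V where V: "V \<in> carrier_mat m r" "entries_in {0..} V"
    and VV: "adj V * V = 1\<^sub>m r" and VVHH: "V * adj V = H * adj H"
    and analytic: "\<And>F q. F \<in> carrier_mat m q \<Longrightarrow> entries_in {0..} F \<Longrightarrow> H * (adj H * F) = F \<Longrightarrow>
       entries_in {0..} (adj V * F)"
    by (rule isometric_polynomial_frame[OF H ent(1) HHH]) blast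
  have dV [simp]: "dim_row V = m" "dim_col V = r" using V by auto
  have HHHY: "H * (adj H * (H * Y)) = H * Y" if "dim_row Y = m" for Y
    using arg_cong[OF HHH, of "\<lambda>X. X * Y"] that by (simp add: mat_alg)
  have VVHY: "V * (adj V * (H * Y)) = H * Y" if "dim_row Y = m" for Y
    using arg_cong[OF VVHH, of "\<lambda>X. X * (H * Y)"] that by (simp add: mat_alg HHHY)
  have VVY: "adj V * (V * Y) = Y" if "dim_row Y = r" for Y
    using arg_cong[OF VV, of "\<lambda>X. X * Y"] that by (simp add: mat_alg)
  have HHV: "V = H * (adj H * V)"
    using arg_cong[OF VVHH, of "\<lambda>X. X * V"] by (simp add: mat_alg VV)
  define C0 where "C0 = H * adj P"
  define X where "X = Z * V"
  define Y where "Y = adj Z * (adj H * V)"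
  have dX [simp]: "dim_row C0 = m" "dim_col C0 = N" "dim_row X = m" "dim_col X = r"
    "dim_row Y = m" "dim_col Y = r"
    by (auto simp: C0_def X_def Y_def)
  have XY: "X = H * Y"
  proof -
    have "X = (Z * H) * (adj H * V)" unfolding X_def by (subst HHV) (simp add: mat_alg)
    then show ?thesis by (simp only: ZH) (simp add: mat_alg Y_def)
  qed
  have VVX: "V * (adj V * X) = X" by (simp add: XY VVHY)
  have VVC: "V * (adj V * C0) = C0" by (simp add: C0_def VVHY)
  define B where "B = P * V"
  define C where "C = adj V * C0"
  define D where "D = adj V * X"
  have car: "B \<in> carrier_mat N r" "C \<in> carrier_mat r N" "D \<in> carrier_mat r r"
    by (auto simp: B_def C_def D_def)
  have TV: "adj V * (T * Q) = 0\<^sub>m r (dim_col Q)" if "dim_row Q = m" for Q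
  proof -
    have "adj T * V = (adj T * H) * (adj H * V)" by (subst HHV) (simp add: mat_alg)
    then have "adj (adj T * V) = adj (0\<^sub>m m r)" by (simp add: TH mat_alg)
    then have zero: "adj V * T = 0\<^sub>m r m" by (simp add: mat_alg)
    show ?thesis using arg_cong[OF zero, of "\<lambda>X. X * Q"] that by (simp add: mat_alg)
  qed
  have b11: "adj S0 * S0 + adj C * C = 1\<^sub>m N"
  proof -
    have "adj C * C = adj C0 * C0" by (simp add: C_def mat_alg VVC)
    then show ?thesis using first by (simp add: C0_def)
  qed
  have b21: "adj B * S0 + adj D * C = 0\<^sub>m r N"
  proof -
    have "adj B * S0 + adj D * C = adj V * (adj P * S0 + adj Z * C0)"
      by (simp add: B_def C_def D_def mat_alg VVC) (simp add: X_def mat_alg)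
    also have "\<dots> = adj V * (T * adj P)" using cross by (simp add: C0_def)
    finally show ?thesis by (simp add: TV)
  qed
  have b12: "adj S0 * B + adj C * D = 0\<^sub>m N r"
    using arg_cong[OF b21, of adj] by (simp add: mat_alg C_def D_def B_def)
  have b22: "adj B * B + adj D * D = 1\<^sub>m r"
  proof -
    have "adj B * B + adj D * D = adj V * ((adj P * P + adj Z * Z) * V)"
      by (simp add: B_def D_def mat_alg VVX) (simp add: X_def mat_alg)
    then show ?thesis by (simp add: PZ mat_alg VV)
  qed
  have iso: "adj (four_block_mat S0 B C D) * four_block_mat S0 B C D = 1\<^sub>m (N + r)"
  proof -
    have "adj (four_block_mat S0 B C D) * four_block_mat S0 B C D =
        four_block_mat (adj S0 * S0 + adj C * C) (adj S0 * B + adj C * D)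
          (adj B * S0 + adj D * C) (adj B * B + adj D * D)"
      unfolding adj_four_block[OF S0 car]
      using S0 car by (intro mult_four_block_mat[of _ N N _ r _ r]) auto
    then show ?thesis by (simp add: b11 b12 b21 b22)
  qed
  have eB: "entries_in {0..} B"
    unfolding B_def by (rule entries_in_mult[OF ent(2) V(2) P V(1)]) auto
  have eC: "entries_in {0..} C"
    unfolding C_def
  proof (rule analytic)
    show "entries_in {0..} C0" unfolding C0_def
      by (rule entries_in_mult[OF ent(1) entries_in_adj[OF ent(2), of "{0}"] H adj_carrier[OF P]]) auto
  qed (auto simp: C0_def HHHY)
  have eD: "entries_in {0..} D"
    unfolding D_def
  proof (rule analytic)
    show "entries_in {0..} X" unfolding X_def
      by (rule entries_in_mult[OF ent(3) V(2) Z V(1)]) auto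
    show "H * (adj H * X) = X" by (simp add: XY HHHY)
  qed auto
  have powers: "V * (D ^\<^sub>m k * (adj V * H)) = Z ^\<^sub>m k * H" for k
  proof (induction k)
    case 0
    show ?case using VVHY[of "1\<^sub>m m"] by (simp add: D_def mat_alg)
  next
    case (Suc k)
    have dD: "dim_row D = r" "dim_col D = r" by (simp_all add: D_def)
    have "V * (D ^\<^sub>m Suc k * (adj V * H)) = V * (D ^\<^sub>m k * (adj V * (Z * (V * (adj V * H)))))"
      by (simp add: mat_alg dD) (simp add: D_def X_def mat_alg)
    also have "V * (adj V * H) = H" using VVHY[of "1\<^sub>m m"] by (simp add: mat_alg)
    also have "V * (D ^\<^sub>m k * (adj V * (Z * H))) = V * (D ^\<^sub>m k * (adj V * H)) * adj Z"
      by (simp add: ZH mat_alg dD)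
    also have "\<dots> = Z ^\<^sub>m k * H * adj Z" by (simp only: Suc.IH)
    also have "\<dots> = Z ^\<^sub>m Suc k * H" by (simp add: mat_alg ZH)
    finally show ?case .
  qed
  have dD [simp]: "dim_row D = r" "dim_col D = r" by (simp_all add: D_def)
  have moments: "B * (D ^\<^sub>m k * C) = P * (Z ^\<^sub>m k * (H * adj P))" for k
  proof -
    have "B * (D ^\<^sub>m k * C) = P * ((V * (D ^\<^sub>m k * (adj V * H))) * adj P)"
      by (simp add: B_def C_def C0_def mat_alg)
    then show ?thesis by (simp only: powers) (simp add: mat_alg)
  qed
  have nil: "D ^\<^sub>m k = 0\<^sub>m r r" if "Z ^\<^sub>m k = 0\<^sub>m m m" for k
  proof -
    have "D ^\<^sub>m k = adj V * ((V * (D ^\<^sub>m k * (adj V * H))) * (adj H * V))"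
      by (simp add: mat_alg VVY VV flip: HHV)
    then show ?thesis by (simp only: powers that) (simp add: mat_alg)
  qed
  show ?thesis by (rule that[OF car iso eB eC eD moments nil])
qed

section \<open>The Hankel and Toeplitz matrices of a unitary polynomial\<close>

lemma sum_blocks: "(\<Sum>l<n * N. f (l div N) (l mod N)) = (\<Sum>k<n. \<Sum>c<N. f k c)"
  for f :: "nat \<Rightarrow> nat \<Rightarrow> 'a::comm_monoid_add"
proof -
  have "(\<Sum>l<n * N. f (l div N) (l mod N)) = (\<Sum>k<n. \<Sum>l = k * N..<k * N + N. f (l div N) (l mod N))"
    by (rule sum.nat_group[symmetric])
  also have "\<dots> = (\<Sum>k<n. \<Sum>c<N. f k c)"
  proof (rule sum.cong[OF refl])
    fix k
    have "(\<Sum>l = k * N..<k * N + N. f (l div N) (l mod N)) =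
        (\<Sum>c<N. f ((k * N + c) div N) ((k * N + c) mod N))"
      by (rule sum.reindex_bij_witness[of _ "\<lambda>c. k * N + c" "\<lambda>l. l - k * N"]) auto
    then show "(\<Sum>l = k * N..<k * N + N. f (l div N) (l mod N)) = (\<Sum>c<N. f k c)"
      by simp
  qed
  finally show ?thesis .
qed

lemma sum_int_window_up: "(\<Sum>k<n. g (a + int k)) = sum g {a..<a + int n}"
  by (rule sum.reindex_bij_witness[of _ "\<lambda>x. nat (x - a)" "\<lambda>k. a + int k"]) auto

lemma sum_int_window_down: "(\<Sum>k<n. g (a - int k)) = sum g {a - int n<..a}"
  by (rule sum.reindex_bij_witness[of _ "\<lambda>x. nat (a - x)" "\<lambda>k. a - int k"]) auto

lemma sum_delta_mult:
  fixes f :: "nat \<Rightarrow> 'a::semiring_1"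
  shows "(\<Sum>l<n. (if l = i then 1 else 0) * f l) = (if i < n then f i else 0)"
    "(\<Sum>l<n. f l * (if l = i then 1 else 0)) = (if i < n then f i else 0)"
proof -
  have "(\<Sum>l<n. (if l = i then 1 else 0) * f l) = (\<Sum>l<n. if l = i then f l else 0)"
    "(\<Sum>l<n. f l * (if l = i then 1 else 0)) = (\<Sum>l<n. if l = i then f l else 0)"
    by (intro sum.cong; simp)+
  then show "(\<Sum>l<n. (if l = i then 1 else 0) * f l) = (if i < n then f i else 0)"
    "(\<Sum>l<n. f l * (if l = i then 1 else 0)) = (if i < n then f i else 0)"
    by simp_all
qed

lemma index_mult_mat_sum:
  "i < dim_row A \<Longrightarrow> j < dim_col B \<Longrightarrow> dim_col A = dim_row B \<Longrightarrow>
    (A * B) $$ (i, j) = (\<Sum>l<dim_row B. A $$ (i, l) * B $$ (l, j))"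
  by (simp add: scalar_prod_def lessThan_atLeast0)

(* Entries of products are to become explicit sums, not scalar products of rows and columns. *)
declare index_mult_mat(1) [simp del]

text \<open>
  With vectors of length \<open>m = n N\<close> read as \<open>n\<close> blocks of length \<open>N\<close>, the following matrices shift the
  blocks upwards and select the first block.
\<close>

definition block_shift :: "nat \<Rightarrow> nat \<Rightarrow> laurent mat" where
  "block_shift N m = mat m m (\<lambda>(i, j). if j = i + N then 1 else 0)"

definition block_first :: "nat \<Rightarrow> nat \<Rightarrow> laurent mat" where
  "block_first N m = mat N m (\<lambda>(i, j). if j = i then 1 else 0)"

lemma dim_block_shift [simp]: "dim_row (block_shift N m) = m" "dim_col (block_shift N m) = m"
  by (simp_all add: block_shift_def)

lemma dim_block_first [simp]: "dim_row (block_first N m) = N" "dim_col (block_first N m) = m"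
  by (simp_all add: block_first_def)

lemma index_block_shift_mult:
  assumes "dim_row X = m" "i < m" "j < dim_col X"
  shows "(block_shift N m * X) $$ (i, j) = (if i + N < m then X $$ (i + N, j) else 0)"
proof -
  have "(block_shift N m * X) $$ (i, j) = (\<Sum>l<m. (if l = i + N then 1 else 0) * X $$ (l, j))"
    using assms by (subst index_mult_mat_sum) (auto simp: block_shift_def intro!: sum.cong)
  then show ?thesis by (simp add: sum_delta_mult)
qed

lemma index_adj_block_shift_mult:
  assumes "dim_row X = m" "i < m" "j < dim_col X"
  shows "(adj (block_shift N m) * X) $$ (i, j) = (if N \<le> i then X $$ (i - N, j) else 0)"
proof -
  have "(adj (block_shift N m) * X) $$ (i, j) =
      (\<Sum>l<m. if N \<le> i then (if l = i - N then 1 else 0) * X $$ (l, j) else 0)"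
    using assms by (subst index_mult_mat_sum) (auto simp: block_shift_def intro!: sum.cong)
  moreover have "i - N < m" using assms by simp
  ultimately show ?thesis by (simp add: sum_delta_mult)
qed

lemma index_block_first_mult:
  assumes "dim_row X = m" "i < N" "j < dim_col X"
  shows "(block_first N m * X) $$ (i, j) = (if i < m then X $$ (i, j) else 0)"
proof -
  have "(block_first N m * X) $$ (i, j) = (\<Sum>l<m. (if l = i then 1 else 0) * X $$ (l, j))"
    using assms by (subst index_mult_mat_sum) (auto simp: block_first_def intro!: sum.cong)
  then show ?thesis by (simp add: sum_delta_mult)
qed

lemma index_adj_block_first_mult:
  assumes "dim_row X = N" "i < m" "j < dim_col X"
  shows "(adj (block_first N m) * X) $$ (i, j) = (if i < N then X $$ (i, j) else 0)"
proof -
  have "(adj (block_first N m) * X) $$ (i, j) = (\<Sum>l<N. (if l = i then 1 else 0) * X $$ (l, j))"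
    using assms by (subst index_mult_mat_sum) (auto simp: block_first_def intro!: sum.cong)
  then show ?thesis by (simp add: sum_delta_mult)
qed

lemma index_mult_adj_block_first:
  assumes "dim_col X = m" "i < dim_row X" "j < N"
  shows "(X * adj (block_first N m)) $$ (i, j) = (if j < m then X $$ (i, j) else 0)"
proof -
  have "(X * adj (block_first N m)) $$ (i, j) = (\<Sum>l<m. X $$ (i, l) * (if l = j then 1 else 0))"
    using assms by (subst index_mult_mat_sum) (auto simp: block_first_def intro!: sum.cong)
  then show ?thesis by (simp add: sum_delta_mult)
qed

lemma index_mult_adj_block_shift:
  assumes "dim_col X = m" "i < dim_row X" "j < m"
  shows "(X * adj (block_shift N m)) $$ (i, j) = (if j + N < m then X $$ (i, j + N) else 0)"
proof -
  have "(X * adj (block_shift N m)) $$ (i, j) = (\<Sum>l<m. X $$ (i, l) * (if l = j + N then 1 else 0))"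
    using assms by (subst index_mult_mat_sum) (auto simp: block_shift_def intro!: sum.cong)
  then show ?thesis by (simp add: sum_delta_mult)
qed

lemma index_block_shift_pow_mult:
  assumes "dim_row X = m" "i < m" "j < dim_col X"
  shows "(block_shift N m ^\<^sub>m k * X) $$ (i, j) = (if i + k * N < m then X $$ (i + k * N, j) else 0)"
  using assms
proof (induction k arbitrary: X)
  case 0
  then show ?case by (simp add: mat_alg)
next
  case (Suc k)
  have "block_shift N m ^\<^sub>m Suc k * X = block_shift N m ^\<^sub>m k * (block_shift N m * X)"
    using Suc.prems by (simp add: mat_alg)
  also have "\<dots> $$ (i, j) = (if i + k * N < m then (block_shift N m * X) $$ (i + k * N, j) else 0)"
    using Suc.prems by (intro Suc.IH) simp_all
  finally show ?case
    using Suc.prems by (simp add: index_block_shift_mult add.commute add.left_commute)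
qed

text \<open>
  Here \<open>s k a b\<close> is the entry \<open>(a, b)\<close> of the coefficient \<open>S\<^sub>k\<close>, continued by zero to all integers \<open>k\<close>,
  and the two summation conditions are \<open>S\<^sup>* S = I\<close> and \<open>S S\<^sup>* = I\<close>, sorted by powers of \<open>z\<^sub>2\<close>.  An
  entry of \<open>H H\<^sup>* + T T\<^sup>*\<close> is the sum in the second condition, cut into the terms with index
  above \<open>J\<close> and those with index up to \<open>J\<close>; an entry of \<open>T\<^sup>* H\<close> is the sum in the first condition for a positive
  shift \<open>l\<close>.  These identities make \<open>H\<close> a partial isometry.
\<close>

lemma hankel_toeplitz_colligation:
  fixes s :: "int \<Rightarrow> nat \<Rightarrow> nat \<Rightarrow> laurent" and N n :: nat
  assumes s0: "\<And>k a b. k \<notin> {0..int n} \<Longrightarrow> s k a b = 0"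
    and supp: "\<And>k a b. a < N \<Longrightarrow> b < N \<Longrightarrow> supp (s k a b) \<subseteq> {0..}"
    and left: "\<And>l a b. a < N \<Longrightarrow> b < N \<Longrightarrow>
      (\<Sum>k\<in>{0..int n}. \<Sum>c<N. lconj (s k c a) * s (k + l) c b) = (if l = 0 \<and> a = b then 1 else 0)"
    and right: "\<And>l a b. a < N \<Longrightarrow> b < N \<Longrightarrow>
      (\<Sum>k\<in>{0..int n}. \<Sum>c<N. s (k + l) a c * lconj (s k b c)) = (if l = 0 \<and> a = b then 1 else 0)"
  defines "S0 \<equiv> mat N N (\<lambda>(a, b). s 0 a b)"
  obtains r B C D where "B \<in> carrier_mat N r" "C \<in> carrier_mat r N" "D \<in> carrier_mat r r"
    "adj (four_block_mat S0 B C D) * four_block_mat S0 B C D = 1\<^sub>m (N + r)"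
    "entries_in {0..} B" "entries_in {0..} C" "entries_in {0..} D"
    "\<And>k. B * (D ^\<^sub>m k * C) = mat N N (\<lambda>(a, b). s (int k + 1) a b)"
    "D ^\<^sub>m n = 0\<^sub>m r r"
proof -
  define m where "m = n * N"
  define H where "H = mat m m (\<lambda>(i, j). s (int (i div N) + int (j div N) + 1) (i mod N) (j mod N))"
  define T where "T = mat m m (\<lambda>(i, j). s (int (i div N) - int (j div N)) (i mod N) (j mod N))"
  define P where "P = block_first N m"
  define Z where "Z = block_shift N m"
  have d [simp]: "dim_row S0 = N" "dim_col S0 = N" "dim_row P = N" "dim_col P = m"
    "dim_row Z = m" "dim_col Z = m" "dim_row H = m" "dim_col H = m" "dim_row T = m" "dim_col T = m"
    by (auto simp: S0_def P_def Z_def H_def T_def)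
  have blk: "i div N < n" "i mod N < N" "0 < N" if "i < m" for i
    using that by (cases "N = 0"; simp add: m_def less_mult_imp_div_less)+
  have iH: "H $$ (i, j) = s (int (i div N) + int (j div N) + 1) (i mod N) (j mod N)"
    if "i < m" "j < m" for i j using that by (simp add: H_def)
  have iT: "T $$ (i, j) = s (int (i div N) - int (j div N)) (i mod N) (j mod N)"
    if "i < m" "j < m" for i j using that by (simp add: T_def)
  have same: "i = j \<longleftrightarrow> i div N = j div N \<and> i mod N = j mod N" for i j :: nat
    by (metis div_mult_mod_eq)
  have aN: "a < m" "a div N = 0" "a mod N = a" if "a < N" "i < m" for a i
  proof -
    have "N \<le> m" using blk[OF that(2)] unfolding m_def by (cases n) auto
    then show "a < m" "a div N = 0" "a mod N = a" using that by auto
  qed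
  have HT: "H * adj H + T * adj T = 1\<^sub>m m"
  proof (rule eq_matI)
    fix i j assume "i < dim_row (1\<^sub>m m :: laurent mat)" "j < dim_col (1\<^sub>m m :: laurent mat)"
    then have ij: "i < m" "j < m" by auto
    define I J a b where "I = int (i div N)" and "J = int (j div N)" and "a = i mod N" and "b = j mod N"
    have J: "0 \<le> J" "J < int n" and ab: "a < N" "b < N" using blk[OF ij(1)] blk[OF ij(2)] by (auto simp: J_def a_def b_def)
    define g where "g x = (\<Sum>c<N. s (x + (I - J)) a c * lconj (s x b c))" for x
    have g0: "g x = 0" if "x \<notin> {0..int n}" for x using s0[OF that] by (simp add: g_def)
    have "(H * adj H) $$ (i, j) = (\<Sum>l<m. H $$ (i, l) * lconj (H $$ (j, l)))"
      using ij by (simp add: index_mult_mat_sum)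
    also have "\<dots> = (\<Sum>l<m. s (I + int (l div N) + 1) a (l mod N) * lconj (s (J + int (l div N) + 1) b (l mod N)))"
      using ij by (intro sum.cong) (auto simp: iH I_def J_def a_def b_def)
    also have "\<dots> = (\<Sum>k<n. \<Sum>c<N. s (I + int k + 1) a c * lconj (s (J + int k + 1) b c))"
      unfolding m_def by (rule sum_blocks[of "\<lambda>k c. s (I + int k + 1) a c * lconj (s (J + int k + 1) b c)"])
    also have "\<dots> = (\<Sum>k<n. g ((J + 1) + int k))"
      unfolding g_def by (intro sum.cong refl) (simp add: algebra_simps)
    also have "\<dots> = sum g {J + 1..<J + 1 + int n}" by (rule sum_int_window_up)
    finally have HH: "(H * adj H) $$ (i, j) = sum g {J + 1..<J + 1 + int n}" .
    have "(T * adj T) $$ (i, j) = (\<Sum>l<m. T $$ (i, l) * lconj (T $$ (j, l)))"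
      using ij by (simp add: index_mult_mat_sum)
    also have "\<dots> = (\<Sum>l<m. s (I - int (l div N)) a (l mod N) * lconj (s (J - int (l div N)) b (l mod N)))"
      using ij by (intro sum.cong) (auto simp: iT I_def J_def a_def b_def)
    also have "\<dots> = (\<Sum>k<n. \<Sum>c<N. s (I - int k) a c * lconj (s (J - int k) b c))"
      unfolding m_def by (rule sum_blocks[of "\<lambda>k c. s (I - int k) a c * lconj (s (J - int k) b c)"])
    also have "\<dots> = (\<Sum>k<n. g (J - int k))"
      unfolding g_def by (intro sum.cong refl) (simp add: algebra_simps)
    also have "\<dots> = sum g {J - int n<..J}" by (rule sum_int_window_down)
    finally have TT: "(T * adj T) $$ (i, j) = sum g {J - int n<..J}" .
    have "sum g {J + 1..<J + 1 + int n} + sum g {J - int n<..J} =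
        sum g ({J + 1..<J + 1 + int n} \<union> {J - int n<..J})"
      by (rule sum.union_disjoint[symmetric]) auto
    also have "\<dots> = sum g {0..int n}"
      by (rule sum.mono_neutral_right) (use J g0 in auto)
    also have "\<dots> = (if I - J = 0 \<and> a = b then 1 else 0)"
      unfolding g_def by (rule right[OF ab])
    finally show "(H * adj H + T * adj T) $$ (i, j) = 1\<^sub>m m $$ (i, j)"
      using ij same[of i j] by (simp add: HH TT I_def J_def a_def b_def)
  qed auto
  have TH: "adj T * H = 0\<^sub>m m m"
  proof (rule eq_matI)
    fix i j assume "i < dim_row (0\<^sub>m m m :: laurent mat)" "j < dim_col (0\<^sub>m m m :: laurent mat)"
    then have ij: "i < m" "j < m" by auto
    define I J a b where "I = int (i div N)" and "J = int (j div N)" and "a = i mod N" and "b = j mod N"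
    have IJ: "0 \<le> I" "I < int n" "0 \<le> J" and ab: "a < N" "b < N"
      using blk[OF ij(1)] blk[OF ij(2)] by (auto simp: I_def J_def a_def b_def)
    define g where "g x = (\<Sum>c<N. lconj (s x c a) * s (x + (I + J + 1)) c b)" for x
    have g0: "g x = 0" if "x \<notin> {0..<int n - I}" for x
    proof -
      have "x \<notin> {0..int n} \<or> x + (I + J + 1) \<notin> {0..int n}" using that IJ by auto
      then show ?thesis using s0 by (auto simp: g_def)
    qed
    have "(adj T * H) $$ (i, j) = (\<Sum>l<m. lconj (T $$ (l, i)) * H $$ (l, j))"
      using ij by (simp add: index_mult_mat_sum)
    also have "\<dots> = (\<Sum>l<m. lconj (s (int (l div N) - I) (l mod N) a) * s (int (l div N) + J + 1) (l mod N) b)"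
      using ij by (intro sum.cong) (auto simp: iT iH I_def J_def a_def b_def)
    also have "\<dots> = (\<Sum>k<n. \<Sum>c<N. lconj (s (int k - I) c a) * s (int k + J + 1) c b)"
      unfolding m_def by (rule sum_blocks[of "\<lambda>k c. lconj (s (int k - I) c a) * s (int k + J + 1) c b"])
    also have "\<dots> = (\<Sum>k<n. g (- I + int k))"
      unfolding g_def by (intro sum.cong refl) (simp add: algebra_simps)
    also have "\<dots> = sum g {- I..<- I + int n}" by (rule sum_int_window_up)
    also have "\<dots> = sum g {0..<int n - I}"
      by (rule sum.mono_neutral_right) (use IJ g0 in auto)
    also have "\<dots> = sum g {0..int n}"
      by (rule sum.mono_neutral_left) (use IJ g0 in auto)
    also have "\<dots> = 0" unfolding g_def using left[OF ab, of "I + J + 1"] IJ by simp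
    finally show "(adj T * H) $$ (i, j) = 0\<^sub>m m m $$ (i, j)" using ij by simp
  qed auto
  have ZH: "Z * H = H * adj Z"
  proof (rule eq_matI)
    fix i j assume "i < dim_row (H * adj Z)" "j < dim_col (H * adj Z)"
    then have ij: "i < m" "j < m" by auto
    have N: "0 < N" using blk ij by blast
    have out: "s (int (i div N) + int (j div N) + 2) a b = 0" if "m \<le> i + N \<or> m \<le> j + N" for a b
    proof -
      have "n \<le> i div N + 1 \<or> n \<le> j div N + 1"
      proof -
        have "n \<le> x div N + 1" if "m \<le> x + N" for x
        proof -
          have "n * N div N \<le> (x + N) div N" using that unfolding m_def by (rule div_le_mono)
          then show ?thesis using N by simp
        qed
        then show ?thesis using that by blast
      qed
      then show ?thesis by (intro s0) auto
    qed
    have "(Z * H) $$ (i, j) = s (int (i div N) + int (j div N) + 2) (i mod N) (j mod N)"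
      using ij N out by (simp add: Z_def index_block_shift_mult iH algebra_simps)
    moreover have "(H * adj Z) $$ (i, j) = s (int (i div N) + int (j div N) + 2) (i mod N) (j mod N)"
      using ij N out by (simp add: Z_def index_mult_adj_block_shift iH algebra_simps)
    ultimately show "(Z * H) $$ (i, j) = (H * adj Z) $$ (i, j)" by simp
  qed auto
  have PZ: "adj P * P + adj Z * Z = 1\<^sub>m m"
  proof (rule eq_matI)
    fix i j assume "i < dim_row (1\<^sub>m m :: laurent mat)" "j < dim_col (1\<^sub>m m :: laurent mat)"
    then have ij: "i < m" "j < m" by auto
    have "(adj P * P) $$ (i, j) = (if i < N then P $$ (i, j) else 0)"
      using ij by (simp add: P_def index_adj_block_first_mult)
    moreover have "(adj Z * Z) $$ (i, j) = (if N \<le> i then Z $$ (i - N, j) else 0)"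
      using ij by (simp add: Z_def index_adj_block_shift_mult)
    ultimately show "(adj P * P + adj Z * Z) $$ (i, j) = 1\<^sub>m m $$ (i, j)"
      using ij by (auto simp: P_def Z_def block_first_def block_shift_def)
  qed auto
  have iC: "(H * adj P) $$ (i, a) = s (int (i div N) + 1) (i mod N) a" if "i < m" "a < N" for i a
    using that aN[OF that(2,1)] by (simp add: P_def index_mult_adj_block_first iH)
  have first: "adj S0 * S0 + adj (H * adj P) * (H * adj P) = 1\<^sub>m N"
  proof (rule eq_matI)
    fix a b assume "a < dim_row (1\<^sub>m N :: laurent mat)" "b < dim_col (1\<^sub>m N :: laurent mat)"
    then have ab: "a < N" "b < N" by auto
    define g where "g x = (\<Sum>c<N. lconj (s x c a) * s (x + 0) c b)" for x
    have "(adj S0 * S0) $$ (a, b) = g 0"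
      using ab by (simp add: index_mult_mat_sum g_def S0_def)
    moreover have "(adj (H * adj P) * (H * adj P)) $$ (a, b) = sum g {1..<1 + int n}"
    proof -
      have "(adj (H * adj P) * (H * adj P)) $$ (a, b) =
          (\<Sum>l<m. lconj ((H * adj P) $$ (l, a)) * (H * adj P) $$ (l, b))"
        using ab by (subst index_mult_mat_sum) (auto intro!: sum.cong)
      also have "\<dots> = (\<Sum>l<m. lconj (s (int (l div N) + 1) (l mod N) a) * s (int (l div N) + 1) (l mod N) b)"
        using ab by (intro sum.cong) (auto simp: iC)
      also have "\<dots> = (\<Sum>k<n. \<Sum>c<N. lconj (s (int k + 1) c a) * s (int k + 1) c b)"
        unfolding m_def by (rule sum_blocks[of "\<lambda>k c. lconj (s (int k + 1) c a) * s (int k + 1) c b"])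
      also have "\<dots> = (\<Sum>k<n. g (1 + int k))"
        unfolding g_def by (intro sum.cong refl) (simp add: algebra_simps)
      also have "\<dots> = sum g {1..<1 + int n}" by (rule sum_int_window_up)
      finally show ?thesis .
    qed
    moreover have "g 0 + sum g {1..<1 + int n} = sum g {0..int n}"
    proof -
      have "{0..int n} = insert 0 {1..<1 + int n}" by auto
      then show ?thesis by simp
    qed
    moreover have "sum g {0..int n} = (if (0::int) = 0 \<and> a = b then 1 else 0)"
      unfolding g_def by (rule left[OF ab])
    ultimately show "(adj S0 * S0 + adj (H * adj P) * (H * adj P)) $$ (a, b) = 1\<^sub>m N $$ (a, b)"
      using ab by simp
  qed auto
  have cross: "adj P * S0 + adj Z * (H * adj P) = T * adj P"
  proof (rule eq_matI)
    fix i a assume "i < dim_row (T * adj P)" "a < dim_col (T * adj P)"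
    then have ia: "i < m" "a < N" by auto
    have "(T * adj P) $$ (i, a) = s (int (i div N)) (i mod N) a"
      using ia aN[OF ia(2,1)] by (simp add: P_def index_mult_adj_block_first iT)
    moreover have "(adj P * S0) $$ (i, a) = (if i < N then s 0 i a else 0)"
      using ia by (simp add: P_def index_adj_block_first_mult S0_def)
    moreover have "(adj Z * (H * adj P)) $$ (i, a) = (if N \<le> i then s (int (i div N)) (i mod N) a else 0)"
    proof (cases "N \<le> i")
      case True
      then have "i div N = Suc ((i - N) div N)" "i mod N = (i - N) mod N"
        using blk[OF ia(1)] by (simp_all add: le_div_geq le_mod_geq)
      then show ?thesis
        using ia True iC[of "i - N" a]
        by (simp add: Z_def index_adj_block_shift_mult add.commute)
    next
      case False
      then show ?thesis using ia by (simp add: Z_def index_adj_block_shift_mult)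
    qed
    ultimately show "(adj P * S0 + adj Z * (H * adj P)) $$ (i, a) = (T * adj P) $$ (i, a)"
      using ia by simp
  qed auto
  obtain d :: int where d: "entries_in {0..d} H"
  proof -
    obtain k where "entries_in {..<int k} H" using entries_bounded by blast
    moreover have "entries_in {0..} H"
      using supp blk by (auto simp: entries_in_def iH)
    ultimately have "entries_in ({..<int k} \<inter> {0..}) H" by (rule entries_in_Int)
    then have "entries_in {0..int k} H" by (rule entries_in_mono) auto
    then show ?thesis by (rule that)
  qed
  have eP: "entries_in {0} P" "entries_in {0} Z"
    by (auto simp: P_def Z_def block_first_def block_shift_def entries_in_def)
  have "\<exists>r B C D. B \<in> carrier_mat N r \<and> C \<in> carrier_mat r N \<and> D \<in> carrier_mat r r \<and>
    adj (four_block_mat S0 B C D) * four_block_mat S0 B C D = 1\<^sub>m (N + r) \<and>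
    entries_in {0..} B \<and> entries_in {0..} C \<and> entries_in {0..} D \<and>
    (\<forall>k. B * (D ^\<^sub>m k * C) = P * (Z ^\<^sub>m k * (H * adj P))) \<and>
    (\<forall>k. Z ^\<^sub>m k = 0\<^sub>m m m \<longrightarrow> D ^\<^sub>m k = 0\<^sub>m r r)"
    by (rule compress_colligation[OF _ _ _ _ _ HT TH ZH PZ first cross d eP]) (auto 4 3)
  then obtain r B C D where *: "B \<in> carrier_mat N r" "C \<in> carrier_mat r N" "D \<in> carrier_mat r r"
    "adj (four_block_mat S0 B C D) * four_block_mat S0 B C D = 1\<^sub>m (N + r)"
    "entries_in {0..} B" "entries_in {0..} C" "entries_in {0..} D"
    and moments: "\<forall>k. B * (D ^\<^sub>m k * C) = P * (Z ^\<^sub>m k * (H * adj P))"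
    and nil: "\<forall>k. Z ^\<^sub>m k = 0\<^sub>m m m \<longrightarrow> D ^\<^sub>m k = 0\<^sub>m r r"
    by (elim exE conjE)
  have "P * (Z ^\<^sub>m k * (H * adj P)) = mat N N (\<lambda>(a, b). s (int k + 1) a b)" for k
  proof (rule eq_matI)
    fix a b assume "a < dim_row (mat N N (\<lambda>(a, b). s (int k + 1) a b))"
      "b < dim_col (mat N N (\<lambda>(a, b). s (int k + 1) a b))"
    then have ab: "a < N" "b < N" by auto
    have lt: "a + k * N < m \<longleftrightarrow> k < n"
    proof
      assume "a + k * N < m"
      then have "k * N < n * N" unfolding m_def by linarith
      then show "k < n" by simp
    next
      assume "k < n"
      then have "Suc k * N \<le> n * N" by (intro mult_le_mono1) simp
      then show "a + k * N < m" using ab unfolding m_def by simp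
    qed
    have dk: "dim_row (Z ^\<^sub>m k) = m" "dim_col (Z ^\<^sub>m k) = m" by (simp_all add: dim_pow_mat)
    have "(P * (Z ^\<^sub>m k * (H * adj P))) $$ (a, b) =
        (if a < m then (Z ^\<^sub>m k * (H * adj P)) $$ (a, b) else 0)"
      unfolding P_def using ab dk by (subst index_block_first_mult) auto
    also have "\<dots> = (if a + k * N < m then (H * adj P) $$ (a + k * N, b) else 0)"
      unfolding Z_def using ab by (auto simp: index_block_shift_pow_mult)
    also have "\<dots> = s (int k + 1) a b"
      using ab lt iC[of "a + k * N" b] s0[of "int k + 1" a b] by auto
    finally show "(P * (Z ^\<^sub>m k * (H * adj P))) $$ (a, b) = mat N N (\<lambda>(a, b). s (int k + 1) a b) $$ (a, b)"
      using ab by simp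
  qed (simp_all)
  moreover have "Z ^\<^sub>m n = 0\<^sub>m m m"
  proof -
    have "Z ^\<^sub>m n * 1\<^sub>m m = 0\<^sub>m m m"
    proof (rule eq_matI)
      fix i j assume "i < dim_row (0\<^sub>m m m :: laurent mat)" "j < dim_col (0\<^sub>m m m :: laurent mat)"
      then have ij: "i < m" "j < m" by auto
      have "(Z ^\<^sub>m n * 1\<^sub>m m) $$ (i, j) = (if i + n * N < m then 1\<^sub>m m $$ (i + n * N, j) else 0)"
        unfolding Z_def using ij by (intro index_block_shift_pow_mult) auto
      then show "(Z ^\<^sub>m n * 1\<^sub>m m) $$ (i, j) = 0\<^sub>m m m $$ (i, j)"
        using ij by (simp add: m_def)
    qed (simp_all add: dim_pow_mat)
    then show ?thesis by (simp add: mult_one_dim dim_pow_mat)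
  qed
  ultimately show ?thesis using * moments nil by (intro that[of B r C D]) auto
qed

section \<open>Realization in one of two variables\<close>

lemma leval_sum: "leval z (sum h X) = (\<Sum>x\<in>X. leval z (h x))"
  by (induction X rule: infinite_finite_induct) (simp_all add: leval_add)

lemma laurent_eqI_unit_circle:
  assumes "\<And>z. cmod z = 1 \<Longrightarrow> leval z f = leval z g"
  shows "f = g"
proof -
  have "leval z (f - g) = 0" if "cmod z = 1" for z
    using assms[OF that] leval_add[of z "f - g" g] by simp
  then have "f - g = 0" by (rule laurent_eq_zeroI)
  then show ?thesis by simp
qed

lemma coef_lconj_mult:
  assumes "finite K" "supp f \<subseteq> K"
  shows "coef (lconj f * g) l = (\<Sum>k\<in>K. cnj (coef f k) * coef g (k + l))"
proof -
  have "f = (\<Sum>k\<in>K. mon k (coef f k))"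
    by (subst laurent_as_sum) (rule sum.mono_neutral_left, use assms in \<open>auto simp: in_keys_iff\<close>)
  then have "lconj f = (\<Sum>k\<in>K. mon (- k) (cnj (coef f k)))"
    by (metis (no_types, lifting) lconj_single lconj_sum sum.cong)
  then show ?thesis
    by (simp add: sum_distrib_right lookup_sum lookup_monomial_mult add.commute)
qed

lemma eval2_pCons: "eval2 z1 z2 (pCons a p) = poly a z1 + z2 * eval2 z1 z2 p"
  by (simp add: eval2_def)

lemma eval2_zero [simp]: "eval2 z1 z2 0 = 0"
  by (simp add: eval2_def)

lemma eval2_conv_poly: "eval2 z1 z2 p = poly (map_poly (\<lambda>q. poly q z1) p) z2"
  by (induction p) (simp_all add: eval2_pCons map_poly_pCons)

definition z2_coef :: "complex poly poly \<Rightarrow> int \<Rightarrow> laurent" where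
  "z2_coef p k = (if k < 0 then 0 else lpoly (coeff p (nat k)))"

text \<open>
  An identity on the torus is compared coefficientwise in two rounds: first in \<open>z\<^sub>2\<close> for each
  fixed \<open>z\<^sub>1\<close> on the circle, then in \<open>z\<^sub>1\<close>.
\<close>

lemma torus_identity_coefficients:
  assumes deg: "\<And>c. c < N \<Longrightarrow> degree (u c) \<le> n"
    and torus: "\<And>z1 z2. cmod z1 = 1 \<Longrightarrow> cmod z2 = 1 \<Longrightarrow>
      (\<Sum>c<N. cnj (eval2 z1 z2 (u c)) * eval2 z1 z2 (v c)) = e"
  shows "(\<Sum>k\<in>{0..int n}. \<Sum>c<N. lconj (z2_coef (u c) k) * z2_coef (v c) (k + l)) =
    (if l = 0 then mon 0 e else 0)"
proof (rule laurent_eqI_unit_circle)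
  fix z1 :: complex assume z1: "cmod z1 = 1"
  then have nz: "z1 \<noteq> 0" by auto
  define ev where "ev p = lpoly (map_poly (\<lambda>q. poly q z1) p)" for p
  have ev: "coef (ev p) k = leval z1 (z2_coef p k)" for p k
    by (simp add: ev_def z2_coef_def coeff_map_poly leval_lpoly[OF nz])
  have "(\<Sum>c<N. lconj (ev (u c)) * ev (v c)) = mon 0 e"
  proof (rule laurent_eqI_unit_circle)
    fix z2 :: complex assume z2: "cmod z2 = 1"
    then have "z2 \<noteq> 0" by auto
    then show "leval z2 (\<Sum>c<N. lconj (ev (u c)) * ev (v c)) = leval z2 (mon 0 e)"
      using torus[OF z1 z2]
      by (simp add: leval_sum leval_mult leval_lconj z2 ev_def leval_lpoly eval2_conv_poly)
  qed
  then have "coef (\<Sum>c<N. lconj (ev (u c)) * ev (v c)) l = coef (mon 0 e) l" by simp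
  moreover have "coef (lconj (ev (u c)) * ev (v c)) l =
      (\<Sum>k\<in>{0..int n}. cnj (leval z1 (z2_coef (u c) k)) * leval z1 (z2_coef (v c) (k + l)))"
    if c: "c < N" for c
  proof -
    have "supp (ev (u c)) \<subseteq> {0..int n}"
    proof
      fix k assume "k \<in> supp (ev (u c))"
      then have "0 \<le> k" "coeff (u c) (nat k) \<noteq> 0"
        by (auto simp: in_keys_iff ev z2_coef_def split: if_splits)
      then have "nat k \<le> degree (u c)" by (intro le_degree)
      then show "k \<in> {0..int n}" using deg[OF c] \<open>0 \<le> k\<close> by auto
    qed
    then show ?thesis by (subst coef_lconj_mult) (simp_all add: ev)
  qed
  ultimately have "(\<Sum>c<N. \<Sum>k\<in>{0..int n}. cnj (leval z1 (z2_coef (u c) k)) * leval z1 (z2_coef (v c) (k + l)))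
      = (if l = 0 then e else 0)"
    by (simp add: lookup_sum lookup_single when_def)
  then show "leval z1 (\<Sum>k\<in>{0..int n}. \<Sum>c<N. lconj (z2_coef (u c) k) * z2_coef (v c) (k + l)) =
      leval z1 (if l = 0 then mon 0 e else 0)"
    by (subst (asm) sum.swap) (simp add: leval_sum leval_mult[OF nz] leval_lconj[OF z1])
qed

lemma dim_mat_adjoint [simp]: "dim_row (mat_adjoint A) = dim_col A" "dim_col (mat_adjoint A) = dim_row A"
  by (simp_all add: mat_adjoint_def)

lemma index_mat_adjoint [simp]:
  "i < dim_col A \<Longrightarrow> j < dim_row A \<Longrightarrow> mat_adjoint A $$ (i, j) = conjugate (A $$ (j, i))"
  by (simp add: mat_adjoint_def mat_of_rows_def)

lemma lpoly_mat_exists: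
  assumes "entries_in {0..} M" "M \<in> carrier_mat n m"
  obtains M' where "M' \<in> carrier_mat n m" "M = map_mat lpoly M'"
proof -
  have "\<exists>p. M $$ (i, j) = lpoly p" if "i < n" "j < m" for i j
  proof -
    have "supp (M $$ (i, j)) \<subseteq> {0..}" using assms that unfolding entries_in_def by simp
    then show ?thesis by (rule lpoly_surj) blast
  qed
  then obtain p where p: "\<And>i j. i < n \<Longrightarrow> j < m \<Longrightarrow> M $$ (i, j) = lpoly (p i j)" by metis
  show ?thesis
    by (rule that[of "mat n m (\<lambda>(i, j). p i j)"]) (use assms p in \<open>auto intro!: eq_matI\<close>)
qed

lemma map_mat_lpoly_inject:
  assumes "map_mat lpoly A = map_mat lpoly B"
  shows "A = B"
proof (rule eq_matI)
  have dims: "dim_row A = dim_row B" "dim_col A = dim_col B"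
    using arg_cong[OF assms, of dim_row] arg_cong[OF assms, of dim_col] by auto
  fix i j assume "i < dim_row B" "j < dim_col B"
  then show "A $$ (i, j) = B $$ (i, j)"
    using arg_cong[OF assms, of "\<lambda>M. M $$ (i, j)"] dims by simp
qed (use arg_cong[OF assms, of dim_row] arg_cong[OF assms, of dim_col] in auto)

interpretation lpoly_hom: comm_ring_hom lpoly
  by unfold_locales (simp_all add: lpoly_add lpoly_mult)

lemma isometric_on_circle:
  assumes M: "M \<in> carrier_mat n m" and iso: "adj (map_mat lpoly M) * map_mat lpoly M = 1\<^sub>m m"
    and z: "cmod z = 1"
  shows "isometric_mat (map_mat (\<lambda>p. poly p z) M)"
  unfolding isometric_mat_def
proof (rule eq_matI)
  let ?M = "map_mat (\<lambda>p. poly p z) M"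
  fix i j assume "i < dim_row (1\<^sub>m (dim_col ?M) :: complex mat)" "j < dim_col (1\<^sub>m (dim_col ?M) :: complex mat)"
  then have ij: "i < m" "j < m" using M by auto
  have nz: "z \<noteq> 0" using z by auto
  have "(mat_adjoint ?M * ?M) $$ (i, j) = (\<Sum>l<n. cnj (poly (M $$ (l, i)) z) * poly (M $$ (l, j)) z)"
    using ij M by (subst index_mult_mat_sum) (auto intro!: sum.cong)
  also have "\<dots> = leval z (\<Sum>l<n. lconj (lpoly (M $$ (l, i))) * lpoly (M $$ (l, j)))"
    by (simp add: leval_sum leval_mult nz leval_lconj z leval_lpoly)
  also have "(\<Sum>l<n. lconj (lpoly (M $$ (l, i))) * lpoly (M $$ (l, j))) =
      (adj (map_mat lpoly M) * map_mat lpoly M) $$ (i, j)"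
    using ij M by (subst index_mult_mat_sum) (auto intro!: sum.cong)
  finally show "(mat_adjoint ?M * ?M) $$ (i, j) = 1\<^sub>m (dim_col ?M) $$ (i, j)"
    using ij M by (simp add: iso)
qed (use M in auto)

text \<open>
  The realization in \<open>z\<^sub>2\<close> with coefficients polynomial in \<open>z\<^sub>1\<close>.  The formula
  \<open>S = A + z\<^sub>2 B (I - z\<^sub>2 D)\<^sup>-\<^sup>1 C\<close> is stated through the coefficients of \<open>z\<^sub>2\<^sup>k\<close>, as an identity of
  polynomials, so that it can later be evaluated at every \<open>z\<^sub>1\<close>, also off the circle.
\<close>

lemma kummert_step:
  fixes S :: "complex poly poly mat"
  assumes S: "S \<in> carrier_mat N N"
    and inner: "\<And>z1 z2. cmod z1 = 1 \<Longrightarrow> cmod z2 = 1 \<Longrightarrow>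
           mat_adjoint (eval2_mat S z1 z2) * eval2_mat S z1 z2 = 1\<^sub>m N"
  obtains r n A B C D where "A \<in> carrier_mat N N" "B \<in> carrier_mat N r" "C \<in> carrier_mat r N"
    "D \<in> carrier_mat r r"
    "\<And>z. cmod z = 1 \<Longrightarrow> isometric_mat (map_mat (\<lambda>p. poly p z) (four_block_mat A B C D))"
    "A = map_mat (\<lambda>p. coeff p 0) S"
    "\<And>k. B * (D ^\<^sub>m k * C) = map_mat (\<lambda>p. coeff p (Suc k)) S"
    "D ^\<^sub>m n = 0\<^sub>m r r"
proof -
  define n where "n = Max (insert 0 ((\<lambda>(a, b). degree (S $$ (a, b))) ` ({..<N} \<times> {..<N})))"
  have deg: "degree (S $$ (a, b)) \<le> n" if "a < N" "b < N" for a b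
    unfolding n_def by (intro Max_ge) (use that in force)+
  define s where "s k a b = (if a < N \<and> b < N then z2_coef (S $$ (a, b)) k else 0)" for k a b
  have left: "(\<Sum>c<N. cnj (eval2 z1 z2 (S $$ (c, a))) * eval2 z1 z2 (S $$ (c, b))) = (if a = b then 1 else 0)"
    if "a < N" "b < N" "cmod z1 = 1" "cmod z2 = 1" for a b z1 z2
  proof -
    have "(\<Sum>c<N. cnj (eval2 z1 z2 (S $$ (c, a))) * eval2 z1 z2 (S $$ (c, b))) =
        (mat_adjoint (eval2_mat S z1 z2) * eval2_mat S z1 z2) $$ (a, b)"
      using S that by (subst index_mult_mat_sum) (auto intro!: sum.cong)
    then show ?thesis using inner[OF that(3,4)] that by simp
  qed
  have right: "(\<Sum>c<N. cnj (eval2 z1 z2 (S $$ (b, c))) * eval2 z1 z2 (S $$ (a, c))) = (if a = b then 1 else 0)"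
    if "a < N" "b < N" "cmod z1 = 1" "cmod z2 = 1" for a b z1 z2
  proof -
    let ?E = "eval2_mat S z1 z2"
    have "?E \<in> carrier_mat N N" "mat_adjoint ?E \<in> carrier_mat N N" using S by auto
    then have "?E * mat_adjoint ?E = 1\<^sub>m N"
      using mat_mult_left_right_inverse[of "mat_adjoint ?E" N ?E] inner[OF that(3,4)] by auto
    moreover have "(\<Sum>c<N. cnj (eval2 z1 z2 (S $$ (b, c))) * eval2 z1 z2 (S $$ (a, c))) =
        (?E * mat_adjoint ?E) $$ (a, b)"
      using S that by (subst index_mult_mat_sum) (auto intro!: sum.cong)
    ultimately show ?thesis using that by simp
  qed
  define S0 where "S0 = mat N N (\<lambda>(a, b). s 0 a b)"
  have "\<exists>r B C D. B \<in> carrier_mat N r \<and> C \<in> carrier_mat r N \<and> D \<in> carrier_mat r r \<and>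
    adj (four_block_mat S0 B C D) * four_block_mat S0 B C D = 1\<^sub>m (N + r) \<and>
    entries_in {0..} B \<and> entries_in {0..} C \<and> entries_in {0..} D \<and>
    (\<forall>k. B * (D ^\<^sub>m k * C) = mat N N (\<lambda>(a, b). s (int k + 1) a b)) \<and>
    D ^\<^sub>m n = 0\<^sub>m r r"
    unfolding S0_def
  proof (rule hankel_toeplitz_colligation[of n s N])
    fix k a b assume "k \<notin> {0..int n}"
    then show "s k a b = 0"
      using deg[of a b] by (auto simp: s_def z2_coef_def coeff_eq_0)
  next
    fix k a b show "supp (s k a b) \<subseteq> {0..}"
      by (auto simp: s_def z2_coef_def in_keys_iff split: if_splits)
  next
    fix l a b assume ab: "a < N" "b < N"
    show "(\<Sum>k\<in>{0..int n}. \<Sum>c<N. lconj (s k c a) * s (k + l) c b) = (if l = 0 \<and> a = b then 1 else 0)"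
      using torus_identity_coefficients[of N "\<lambda>c. S $$ (c, a)" n "\<lambda>c. S $$ (c, b)" "if a = b then 1 else 0" l]
        deg left ab by (auto simp: s_def)
    show "(\<Sum>k\<in>{0..int n}. \<Sum>c<N. s (k + l) a c * lconj (s k b c)) = (if l = 0 \<and> a = b then 1 else 0)"
      using torus_identity_coefficients[of N "\<lambda>c. S $$ (b, c)" n "\<lambda>c. S $$ (a, c)" "if a = b then 1 else 0" l]
        deg right ab by (auto simp: s_def mult.commute)
  qed (intro exI conjI allI; assumption)
  then obtain r B C D where car: "B \<in> carrier_mat N r" "C \<in> carrier_mat r N" "D \<in> carrier_mat r r"
    and iso: "adj (four_block_mat S0 B C D) * four_block_mat S0 B C D = 1\<^sub>m (N + r)"
    and ent: "entries_in {0..} B" "entries_in {0..} C" "entries_in {0..} D"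
    and moments: "\<forall>k. B * (D ^\<^sub>m k * C) = mat N N (\<lambda>(a, b). s (int k + 1) a b)"
    and nil: "D ^\<^sub>m n = 0\<^sub>m r r"
    by (elim exE conjE)
  obtain B' where B': "B' \<in> carrier_mat N r" "B = map_mat lpoly B'" by (rule lpoly_mat_exists[OF ent(1) car(1)])
  obtain C' where C': "C' \<in> carrier_mat r N" "C = map_mat lpoly C'" by (rule lpoly_mat_exists[OF ent(2) car(2)])
  obtain D' where D': "D' \<in> carrier_mat r r" "D = map_mat lpoly D'" by (rule lpoly_mat_exists[OF ent(3) car(3)])
  define A' where "A' = map_mat (\<lambda>p. coeff p 0) S"
  have A': "A' \<in> carrier_mat N N" "S0 = map_mat lpoly A'"
    using S by (auto simp: A'_def S0_def s_def z2_coef_def intro!: eq_matI)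
  have "four_block_mat S0 B C D = map_mat lpoly (four_block_mat A' B' C' D')"
    unfolding A'(2) B'(2) C'(2) D'(2) by (rule map_four_block_mat[OF A'(1) B'(1) C'(1) D'(1), symmetric])
  with iso have "isometric_mat (map_mat (\<lambda>p. poly p z) (four_block_mat A' B' C' D'))" if "cmod z = 1" for z
    using A' B' C' D' that by (intro isometric_on_circle[of _ "N + r" "N + r"]) auto
  moreover have "B' * (D' ^\<^sub>m k * C') = map_mat (\<lambda>p. coeff p (Suc k)) S" for k
  proof (rule map_mat_lpoly_inject)
    have "map_mat lpoly (B' * (D' ^\<^sub>m k * C')) = B * (D ^\<^sub>m k * C)"
      by (simp only: B'(2) C'(2) D'(2) lpoly_hom.mat_hom_mult[OF pow_carrier_mat[OF D'(1)] C'(1)]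
          lpoly_hom.mat_hom_mult[OF B'(1) mult_carrier_mat[OF pow_carrier_mat[OF D'(1)] C'(1)]]
          lpoly_hom.mat_hom_pow[OF D'(1)])
    also have "\<dots> = map_mat lpoly (map_mat (\<lambda>p. coeff p (Suc k)) S)"
    proof -
      have "nat (int k + 1) = Suc k" by simp
      then show ?thesis
        using S by (simp add: moments) (intro eq_matI, auto simp: s_def z2_coef_def)
    qed
    finally show "map_mat lpoly (B' * (D' ^\<^sub>m k * C')) = map_mat lpoly (map_mat (\<lambda>p. coeff p (Suc k)) S)" .
  qed
  moreover have "D' ^\<^sub>m n = 0\<^sub>m r r"
  proof (rule map_mat_lpoly_inject)
    show "map_mat lpoly (D' ^\<^sub>m n) = map_mat lpoly (0\<^sub>m r r)"
      using nil D' by (simp add: lpoly_hom.mat_hom_pow[of _ r]) (intro eq_matI, auto)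
  qed
  ultimately show ?thesis using that A'(1) B'(1) C'(1) D'(1) A'_def by blast
qed

section \<open>Closing a feedback loop\<close>

lemma smult_mult_dim: "dim_col A = dim_row B \<Longrightarrow> (k \<cdot>\<^sub>m A) * B = k \<cdot>\<^sub>m (A * B)"
  for A :: "'a::comm_semiring_0 mat"
  by (rule mult_smult_assoc_mat[of A "dim_row A" "dim_row B" B "dim_col B"]) auto

lemma mult_smult_dim: "dim_col A = dim_row B \<Longrightarrow> A * (k \<cdot>\<^sub>m B) = k \<cdot>\<^sub>m (A * B)"
  for A :: "'a::comm_semiring_0 mat"
  by (rule mult_smult_distrib[of A "dim_row A" "dim_row B" B "dim_col B"]) auto

text \<open>
  As a polynomial in \<open>t\<close>, \<open>det (I - t E)\<close> has no zero by assumption, so it is constant by the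
  fundamental theorem of algebra, and its value at \<open>t = 0\<close> is \<open>1\<close>.
\<close>

lemma det_one_minus_eq_one:
  fixes E :: "complex mat"
  assumes E: "E \<in> carrier_mat n n"
    and no_kernel: "\<And>t X. X \<in> carrier_mat n 1 \<Longrightarrow> X = (t \<cdot>\<^sub>m E) * X \<Longrightarrow> X = 0\<^sub>m n 1"
  shows "det (1\<^sub>m n - E) = 1"
proof -
  define M where "M = mat n n (\<lambda>(i, j). [:if i = j then 1 else 0, - (E $$ (i, j)):])"
  have M: "M \<in> carrier_mat n n" by (simp add: M_def)
  have eval: "det (1\<^sub>m n - t \<cdot>\<^sub>m E) = poly (det M) t" for t
  proof -
    have hom: "comm_ring_hom (\<lambda>p :: complex poly. poly p t)"
      by unfold_locales auto
    have "1\<^sub>m n - t \<cdot>\<^sub>m E = map_mat (\<lambda>p. poly p t) M"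
      using E by (intro eq_matI) (auto simp: M_def)
    then show ?thesis using comm_ring_hom.hom_det[OF hom, of M] by simp
  qed
  have "poly (det M) t \<noteq> 0" for t
  proof
    assume "poly (det M) t = 0"
    then have "det (1\<^sub>m n - t \<cdot>\<^sub>m E) = 0" by (simp add: eval)
    moreover have car: "1\<^sub>m n - t \<cdot>\<^sub>m E \<in> carrier_mat n n" using E by auto
    ultimately obtain v where v: "v \<in> carrier_vec n" "v \<noteq> 0\<^sub>v n" "(1\<^sub>m n - t \<cdot>\<^sub>m E) *\<^sub>v v = 0\<^sub>v n"
      using det_0_iff_vec_prod_zero[OF car] by blast
    define X where "X = mat n 1 (\<lambda>(i, _). v $ i)"
    have X: "X \<in> carrier_mat n 1" by (simp add: X_def)
    have "X = (t \<cdot>\<^sub>m E) * X"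
    proof (rule eq_matI)
      fix i j assume "i < dim_row ((t \<cdot>\<^sub>m E) * X)" "j < dim_col ((t \<cdot>\<^sub>m E) * X)"
      then have i: "i < n" and j: "j = 0" using E by (auto simp: X_def)
      have "0 = ((1\<^sub>m n - t \<cdot>\<^sub>m E) *\<^sub>v v) $ i" using v i by simp
      also have "\<dots> = (\<Sum>l<n. ((if i = l then 1 else 0) - t * E $$ (i, l)) * v $ l)"
        using i v(1) E by (simp add: scalar_prod_def lessThan_atLeast0)
      also have "\<dots> = (\<Sum>l<n. (if l = i then 1 else 0) * v $ l) - (\<Sum>l<n. t * E $$ (i, l) * v $ l)"
        by (simp add: sum_subtractf[symmetric] left_diff_distrib) (intro sum.cong, auto)
      also have "\<dots> = v $ i - (\<Sum>l<n. t * E $$ (i, l) * v $ l)"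
        using i by (simp add: sum_delta_mult)
      finally have "v $ i = (\<Sum>l<n. t * E $$ (i, l) * v $ l)" by simp
      moreover have "((t \<cdot>\<^sub>m E) * X) $$ (i, j) = (\<Sum>l<n. t * E $$ (i, l) * v $ l)"
        using i j E by (subst index_mult_mat_sum) (auto simp: X_def intro!: sum.cong)
      ultimately show "X $$ (i, j) = ((t \<cdot>\<^sub>m E) * X) $$ (i, j)" using i j by (simp add: X_def)
    qed (use E in \<open>auto simp: X_def\<close>)
    then have "X = 0\<^sub>m n 1" by (rule no_kernel[OF X])
    then have "X $$ (i, 0) = 0" if "i < n" for i using that by simp
    then have "v = 0\<^sub>v n" using v(1) by (intro eq_vecI) (auto simp: X_def)
    then show False using v(2) by simp
  qed
  then have "constant (poly (det M))" using fundamental_theorem_of_algebra by blast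
  then have "poly (det M) 1 = poly (det M) 0" unfolding constant_def by blast
  moreover have "1\<^sub>m n - 1 \<cdot>\<^sub>m E = 1\<^sub>m n - E" "1\<^sub>m n - 0 \<cdot>\<^sub>m E = 1\<^sub>m n"
    using E by (auto intro!: eq_matI)
  ultimately show ?thesis using eval[of 1] eval[of 0] by simp
qed

lemma nilpotent_no_kernel:
  fixes D :: "complex mat"
  assumes D: "D \<in> carrier_mat r r" and nil: "D ^\<^sub>m n = 0\<^sub>m r r"
    and X: "X \<in> carrier_mat r q" "X = z \<cdot>\<^sub>m (D * X)"
  shows "X = 0\<^sub>m r q"
proof -
  have d: "dim_row D = r" "dim_col D = r" "dim_row X = r" "dim_col X = q" using D X by auto
  have "X = z ^ k \<cdot>\<^sub>m (D ^\<^sub>m k * X)" for k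
  proof (induction k)
    case 0
    show ?case using d by (simp add: mat_alg) (intro eq_matI, auto)
  next
    case (Suc k)
    have "z ^ k \<cdot>\<^sub>m (D ^\<^sub>m k * X) = z ^ k \<cdot>\<^sub>m (D ^\<^sub>m k * (z \<cdot>\<^sub>m (D * X)))"
      using X(2) by simp
    also have "\<dots> = z ^ Suc k \<cdot>\<^sub>m (D ^\<^sub>m Suc k * X)"
      using d by (simp add: mat_alg mult_smult_dim) (intro eq_matI, auto)
    finally show ?case using Suc.IH by simp
  qed
  from this[of n] show ?thesis using d by (simp add: nil mat_alg)
qed

lemma inverse_one_minus:
  fixes E :: "complex mat"
  assumes E: "E \<in> carrier_mat n n" and det: "det (1\<^sub>m n - E) = 1"
  defines "Y \<equiv> the (mat_inverse (1\<^sub>m n - E))"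
  shows "Y \<in> carrier_mat n n" "Y = 1\<^sub>m n + E * Y"
    "\<And>X C q. X \<in> carrier_mat n q \<Longrightarrow> C \<in> carrier_mat n q \<Longrightarrow> X = C + E * X \<Longrightarrow> X = Y * C"
proof -
  let ?G = "1\<^sub>m n - E"
  have G: "?G \<in> carrier_mat n n" using E by auto
  have "?G \<in> Units (ring_mat TYPE(complex) n ())" using det_non_zero_imp_unit[OF G] det by simp
  then obtain W where W: "mat_inverse ?G = Some W" using mat_inverse(1)[OF G] by fastforce
  then have YW: "Y = W" by (simp add: Y_def)
  have inv: "?G * Y = 1\<^sub>m n" "Y * ?G = 1\<^sub>m n" and Y: "Y \<in> carrier_mat n n"
    using mat_inverse(2)[OF G W] by (simp_all add: YW)
  show "Y \<in> carrier_mat n n" by (rule Y)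
  have GX: "?G * X = X - E * X" if "X \<in> carrier_mat n q" for X q
    using minus_mult_distrib_mat[OF one_carrier_mat E that] that by (simp add: one_mult_dim)
  have "Y - E * Y = 1\<^sub>m n" using GX[OF Y] inv by simp
  moreover have "Y = (Y - E * Y) + E * Y" using Y E by (intro eq_matI) auto
  ultimately show "Y = 1\<^sub>m n + E * Y" by simp
  fix X C :: "complex mat" and q
  assume X: "X \<in> carrier_mat n q" and C: "C \<in> carrier_mat n q" and eq: "X = C + E * X"
  have EX: "E * X \<in> carrier_mat n q" using E X by auto
  have "(C + W) - W = C" if "W \<in> carrier_mat n q" for W
    using C that by (intro eq_matI) auto
  then have "(C + E * X) - E * X = C" using EX by blast
  then have "?G * X = C" using GX[OF X] eq by simp
  then have "Y * C = Y * (?G * X)" by simp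
  also have "\<dots> = (Y * ?G) * X" using Y G X by (simp add: assoc_mult_mat[of _ n n _ n _ q])
  also have "\<dots> = X" using inv X by simp
  finally show "X = Y * C" by simp
qed

text \<open>
  The Neumann series of \<open>(I - z D)\<^sup>-\<^sup>1\<close> is finite, so the coefficient identities add up to the transfer
  function.  \<open>Y\<close> is that inverse; its last property says that the loop equation
  \<open>X = G + z D X\<close> is uniquely solvable.
\<close>

lemma realization_one_variable:
  fixes A B C D :: "complex mat" and M :: "complex poly mat"
  assumes M: "M \<in> carrier_mat N q" and A: "A = map_mat (\<lambda>p. coeff p 0) M"
    and B: "B \<in> carrier_mat N r" and C: "C \<in> carrier_mat r q" and D: "D \<in> carrier_mat r r"
    and moments: "\<And>k. B * (D ^\<^sub>m k * C) = map_mat (\<lambda>p. coeff p (Suc k)) M"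
    and nil: "D ^\<^sub>m n = 0\<^sub>m r r"
  shows "\<exists>Y. Y \<in> carrier_mat r r \<and>
    map_mat (\<lambda>p. poly p z) M = A + z \<cdot>\<^sub>m (B * (Y * C)) \<and>
    (\<forall>X G l. X \<in> carrier_mat r l \<longrightarrow> G \<in> carrier_mat r l \<longrightarrow>
      (X = G + z \<cdot>\<^sub>m (D * X) \<longleftrightarrow> X = Y * G))"
proof -
  have d [simp]: "dim_row B = N" "dim_col B = r" "dim_row C = r" "dim_col C = q" "dim_row D = r" "dim_col D = r"
    "dim_row M = N" "dim_col M = q" using B C D M by auto
  have E: "z \<cdot>\<^sub>m D \<in> carrier_mat r r" by auto
  have det: "det (1\<^sub>m r - z \<cdot>\<^sub>m D) = 1"
  proof (rule det_one_minus_eq_one[OF E])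
    fix t X assume X: "X \<in> carrier_mat r 1" "X = (t \<cdot>\<^sub>m (z \<cdot>\<^sub>m D)) * X"
    have "(t \<cdot>\<^sub>m (z \<cdot>\<^sub>m D)) * X = (t * z) \<cdot>\<^sub>m (D * X)"
      using X(1) by (simp add: smult_mult_dim) (intro eq_matI, auto)
    with X show "X = 0\<^sub>m r 1" by (intro nilpotent_no_kernel[OF D nil X(1)]) simp
  qed
  define Y where "Y = the (mat_inverse (1\<^sub>m r - z \<cdot>\<^sub>m D))"
  have Y: "Y \<in> carrier_mat r r" "Y = 1\<^sub>m r + z \<cdot>\<^sub>m D * Y"
    using inverse_one_minus(1,2)[OF E det] unfolding Y_def by blast+
  have dY [simp]: "dim_row Y = r" "dim_col Y = r" using Y(1) by auto
  have Yeq: "Y = 1\<^sub>m r + z \<cdot>\<^sub>m (D * Y)" using Y(2) by (simp add: smult_mult_dim)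
  have expand: "(B * (Y * C)) $$ (a, b) = (\<Sum>j<k. z ^ j * coeff (M $$ (a, b)) (Suc j)) +
      z ^ k * (B * (D ^\<^sub>m k * (Y * C))) $$ (a, b)" if ab: "a < N" "b < q" for a b k
  proof (induction k)
    case 0
    show ?case using ab by (simp add: mat_alg)
  next
    case (Suc k)
    have "B * (D ^\<^sub>m k * (Y * C)) = B * (D ^\<^sub>m k * ((1\<^sub>m r + z \<cdot>\<^sub>m (D * Y)) * C))"
      using Yeq by simp
    also have "\<dots> = B * (D ^\<^sub>m k * C) + z \<cdot>\<^sub>m (B * (D ^\<^sub>m Suc k * (Y * C)))"
      by (simp add: mat_alg mult_smult_dim smult_mult_dim)
    finally have "(B * (D ^\<^sub>m k * (Y * C))) $$ (a, b) =
        coeff (M $$ (a, b)) (Suc k) + z * (B * (D ^\<^sub>m Suc k * (Y * C))) $$ (a, b)"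
      using ab by (simp add: moments)
    then show ?case using Suc.IH by (simp add: algebra_simps)
  qed
  have "map_mat (\<lambda>p. poly p z) M = A + z \<cdot>\<^sub>m (B * (Y * C))"
  proof (rule eq_matI)
    fix a b assume "a < dim_row (A + z \<cdot>\<^sub>m (B * (Y * C)))" "b < dim_col (A + z \<cdot>\<^sub>m (B * (Y * C)))"
    then have ab: "a < N" "b < q" by auto
    let ?p = "M $$ (a, b)"
    have nil': "D ^\<^sub>m j = 0\<^sub>m r r" if "n \<le> j" for j
      using that
    proof (induction j rule: dec_induct)
      case base
      show ?case by (rule nil)
    qed (simp add: mat_alg)
    have deg: "coeff ?p j = 0" if "n < j" for j
    proof -
      obtain i where i: "j = Suc i" "n \<le> i" using \<open>n < j\<close> by (cases j) auto
      have "map_mat (\<lambda>p. coeff p (Suc i)) M = 0\<^sub>m N q"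
        using moments[of i] nil'[OF i(2)] by (simp add: mat_alg)
      then have "map_mat (\<lambda>p. coeff p (Suc i)) M $$ (a, b) = 0" using ab by simp
      then show ?thesis using ab i by simp
    qed
    have "poly ?p z = (\<Sum>j\<le>n. coeff ?p j * z ^ j)"
      unfolding poly_altdef
      by (rule sum.mono_neutral_cong) (use deg in \<open>auto simp: coeff_eq_0 not_le\<close>)
    also have "\<dots> = coeff ?p 0 + z * (\<Sum>j<n. z ^ j * coeff ?p (Suc j))"
      by (simp add: sum.atMost_shift sum_distrib_left ac_simps)
    also have "(\<Sum>j<n. z ^ j * coeff ?p (Suc j)) = (B * (Y * C)) $$ (a, b)"
      using expand[OF ab, of n] ab by (simp add: nil mat_alg)
    finally show "map_mat (\<lambda>p. poly p z) M $$ (a, b) = (A + z \<cdot>\<^sub>m (B * (Y * C))) $$ (a, b)"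
      using ab by (simp add: A)
  qed (auto simp: A)
  moreover have "X = G + z \<cdot>\<^sub>m (D * X) \<longleftrightarrow> X = Y * G"
    if X: "X \<in> carrier_mat r l" and G: "G \<in> carrier_mat r l" for X G l
  proof
    assume "X = G + z \<cdot>\<^sub>m (D * X)"
    then have "X = G + z \<cdot>\<^sub>m D * X" using X by (simp add: smult_mult_dim)
    then show "X = Y * G" using inverse_one_minus(3)[OF E det X G] unfolding Y_def by blast
  next
    have "Y * G = (1\<^sub>m r + z \<cdot>\<^sub>m (D * Y)) * G" using Yeq by simp
    also have "\<dots> = G + z \<cdot>\<^sub>m (D * (Y * G))" using G by (simp add: mat_alg smult_mult_dim)
    finally show "X = G + z \<cdot>\<^sub>m (D * X)" if "X = Y * G" using that by simp
  qed
  ultimately show ?thesis using Y(1) by blast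
qed

lemma four_block_mult_append_rows:
  fixes A B C D X Y :: "'a::comm_ring_1 mat"
  assumes "A \<in> carrier_mat n m" "B \<in> carrier_mat n k" "C \<in> carrier_mat l m" "D \<in> carrier_mat l k"
    "X \<in> carrier_mat m q" "Y \<in> carrier_mat k q"
  shows "four_block_mat A B C D * (X @\<^sub>r Y) = (A * X + B * Y) @\<^sub>r (C * X + D * Y)"
proof -
  have dims: "dim_row X = m" "dim_row Y = k" using assms by auto
  have "four_block_mat A B C D * (X @\<^sub>r Y) =
      four_block_mat (A * X + B * Y) (A * 0\<^sub>m m 0 + B * 0\<^sub>m k 0) (C * X + D * Y) (C * 0\<^sub>m m 0 + D * 0\<^sub>m k 0)"
    unfolding append_rows_def dims using assms
    by (subst mult_four_block_mat[of A n m B k C l D X q "0\<^sub>m m 0" 0 Y "0\<^sub>m k 0"]) auto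
  then show ?thesis using assms by (auto simp: append_rows_def)
qed

lemma append_rows_index:
  assumes "X \<in> carrier_mat m q" "Y \<in> carrier_mat k q" "i < m + k" "j < q"
  shows "(X @\<^sub>r Y) $$ (i, j) = (if i < m then X $$ (i, j) else Y $$ (i - m, j))"
  using assms by (auto simp: append_rows_def)

lemma append_rows_inject:
  assumes "X \<in> carrier_mat m q" "Y \<in> carrier_mat k q" "X' \<in> carrier_mat m q" "Y' \<in> carrier_mat k q"
  shows "X @\<^sub>r Y = X' @\<^sub>r Y' \<longleftrightarrow> X = X' \<and> Y = Y'"
proof
  assume eq: "X @\<^sub>r Y = X' @\<^sub>r Y'"
  have "X $$ (i, j) = X' $$ (i, j)" if "i < m" "j < q" for i j
    using arg_cong[OF eq, of "\<lambda>M. M $$ (i, j)"] that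
    by (simp add: append_rows_index[OF assms(1,2)] append_rows_index[OF assms(3,4)])
  moreover have "Y $$ (i, j) = Y' $$ (i, j)" if "i < k" "j < q" for i j
    using arg_cong[OF eq, of "\<lambda>M. M $$ (m + i, j)"] that
    by (simp add: append_rows_index[OF assms(1,2)] append_rows_index[OF assms(3,4)])
  ultimately show "X = X' \<and> Y = Y'" using assms by (auto intro!: eq_matI)
qed simp

lemma append_rows_assoc:
  assumes "X \<in> carrier_mat m q" "Y \<in> carrier_mat k q" "Z \<in> carrier_mat l q"
  shows "(X @\<^sub>r Y) @\<^sub>r Z = X @\<^sub>r (Y @\<^sub>r Z)"
proof (rule eq_matI)
  have XY: "X @\<^sub>r Y \<in> carrier_mat (m + k) q" and YZ: "Y @\<^sub>r Z \<in> carrier_mat (k + l) q"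
    using assms by auto
  fix i j assume "i < dim_row (X @\<^sub>r (Y @\<^sub>r Z))" "j < dim_col (X @\<^sub>r (Y @\<^sub>r Z))"
  then have ij: "i < m + k + l" "j < q" using carrier_append_rows[OF assms(1) YZ] by auto
  then show "((X @\<^sub>r Y) @\<^sub>r Z) $$ (i, j) = (X @\<^sub>r (Y @\<^sub>r Z)) $$ (i, j)"
    using append_rows_index[OF XY assms(3), of i j] append_rows_index[OF assms(1) YZ, of i j]
      append_rows_index[OF assms(1,2), of i j] append_rows_index[OF assms(2,3), of "i - m" j]
    by auto
qed (use assms in \<open>auto simp: append_rows_def\<close>)

lemma append_rows_split:
  assumes "X \<in> carrier_mat (m + k) q"
  obtains X1 X2 where "X1 \<in> carrier_mat m q" "X2 \<in> carrier_mat k q" "X = X1 @\<^sub>r X2"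
proof
  show a: "mat m q (\<lambda>(i, j). X $$ (i, j)) \<in> carrier_mat m q" by simp
  show b: "mat k q (\<lambda>(i, j). X $$ (m + i, j)) \<in> carrier_mat k q" by simp
  show "X = mat m q (\<lambda>(i, j). X $$ (i, j)) @\<^sub>r mat k q (\<lambda>(i, j). X $$ (m + i, j))"
    using assms append_rows_index[OF a b] by (intro eq_matI) (auto simp: append_rows_def)
qed

section \<open>Realization in both variables\<close>

lemma eval2_constant_in_z1: "eval2 z1 z2 (map_poly (\<lambda>c. [:c:]) p) = poly p z2"
  by (induction p) (simp_all add: eval2_pCons map_poly_pCons)

lemma eval_moments:
  fixes B C D :: "complex poly mat" and z :: complex
  assumes B: "B \<in> carrier_mat N r" and C: "C \<in> carrier_mat r N" and D: "D \<in> carrier_mat r r"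
    and moments: "B * (D ^\<^sub>m k * C) = map_mat (\<lambda>p. coeff p (Suc k)) S"
  defines "ev \<equiv> map_mat (\<lambda>p. poly p z)"
  shows "ev B * (ev D ^\<^sub>m k * ev C) = map_mat (\<lambda>p. coeff p (Suc k)) (map_mat (map_poly (\<lambda>q. poly q z)) S)"
proof -
  have hom: "semiring_hom (\<lambda>p :: complex poly. poly p z)" by unfold_locales auto
  have "ev B * (ev D ^\<^sub>m k * ev C) = ev (B * (D ^\<^sub>m k * C))"
    unfolding ev_def
    by (simp only: semiring_hom.mat_hom_mult[OF hom pow_carrier_mat[OF D] C]
        semiring_hom.mat_hom_mult[OF hom B mult_carrier_mat[OF pow_carrier_mat[OF D] C]]
        semiring_hom.mat_hom_pow[OF hom D])
  also have "\<dots> = map_mat (\<lambda>p. coeff p (Suc k)) (map_mat (map_poly (\<lambda>q. poly q z)) S)"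
    unfolding moments ev_def by (intro eq_matI) (auto simp: coeff_map_poly)
  finally show ?thesis .
qed

lemma eval_nilpotent:
  fixes D :: "complex poly mat"
  assumes D: "D \<in> carrier_mat r r" and nil: "D ^\<^sub>m n = 0\<^sub>m r r"
  shows "map_mat (\<lambda>p. poly p z) D ^\<^sub>m n = 0\<^sub>m r r"
proof -
  have hom: "semiring_hom (\<lambda>p :: complex poly. poly p z)" by unfold_locales auto
  show ?thesis
    using arg_cong[OF nil, of "map_mat (\<lambda>p. poly p z)"]
    by (simp add: semiring_hom.mat_hom_pow[OF hom D]) (intro eq_matI, auto)
qed

text \<open>
  A matrix whose rows are grouped as outputs, outer states and inner states is fed back
  through \<open>z\<^sub>2\<close> and \<open>z\<^sub>1\<close>.  Solving for the inner state \<open>X1\<close> first leaves the system of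
  \<open>A + z\<^sub>1 B (I - z\<^sub>1 D)\<^sup>-\<^sup>1 C\<close>, in which only the outer loop is open.  The equivalence serves twice: with input
  \<open>W = I\<close> it computes the transfer function, with \<open>W = 0\<close> it shows that the closed loop has no
  nonzero solution.
\<close>

lemma close_inner_loop:
  fixes A B C D Y :: "complex mat"
  assumes A: "A \<in> carrier_mat (N + r2) (N + r2)" and B: "B \<in> carrier_mat (N + r2) r1"
    and C: "C \<in> carrier_mat r1 (N + r2)" and D: "D \<in> carrier_mat r1 r1"
    and Y: "Y \<in> carrier_mat r1 r1"
    and solve: "\<And>X G l. X \<in> carrier_mat r1 l \<Longrightarrow> G \<in> carrier_mat r1 l \<Longrightarrow>
      X = G + z1 \<cdot>\<^sub>m (D * X) \<longleftrightarrow> X = Y * G"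
    and blocks: "A + z1 \<cdot>\<^sub>m (B * (Y * C)) = four_block_mat A' B' C' D'"
    and A': "A' \<in> carrier_mat N N" and B': "B' \<in> carrier_mat N r2"
    and C': "C' \<in> carrier_mat r2 N" and D': "D' \<in> carrier_mat r2 r2"
    and W: "W \<in> carrier_mat N q" and Q: "Q \<in> carrier_mat N q"
    and X2: "X2 \<in> carrier_mat r2 q" and X1: "X1 \<in> carrier_mat r1 q"
  shows "four_block_mat A B C D * ((W @\<^sub>r (z2 \<cdot>\<^sub>m X2)) @\<^sub>r (z1 \<cdot>\<^sub>m X1)) = (Q @\<^sub>r X2) @\<^sub>r X1 \<longleftrightarrow>
    X1 = Y * (C * (W @\<^sub>r (z2 \<cdot>\<^sub>m X2))) \<and> X2 = C' * W + z2 \<cdot>\<^sub>m (D' * X2) \<and>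
    Q = A' * W + z2 \<cdot>\<^sub>m (B' * X2)"
proof -
  define w where "w = W @\<^sub>r (z2 \<cdot>\<^sub>m X2)"
  have w: "w \<in> carrier_mat (N + r2) q" using W X2 by (simp add: w_def)
  have zX: "z1 \<cdot>\<^sub>m X1 \<in> carrier_mat r1 q" "z2 \<cdot>\<^sub>m X2 \<in> carrier_mat r2 q" using X1 X2 by auto
  have QX: "Q @\<^sub>r X2 \<in> carrier_mat (N + r2) q" using Q X2 by simp
  have d [simp]: "dim_row A = N + r2" "dim_col A = N + r2" "dim_row B = N + r2" "dim_col B = r1"
    "dim_row C = r1" "dim_col C = N + r2" "dim_row D = r1" "dim_col D = r1" "dim_row Y = r1" "dim_col Y = r1"
    "dim_row w = N + r2" "dim_col w = q" "dim_row X1 = r1" "dim_col X1 = q" "dim_row X2 = r2" "dim_col X2 = q"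
    using A B C D Y w X1 X2 by auto
  have "four_block_mat A B C D * (w @\<^sub>r (z1 \<cdot>\<^sub>m X1)) =
      (A * w + z1 \<cdot>\<^sub>m (B * X1)) @\<^sub>r (C * w + z1 \<cdot>\<^sub>m (D * X1))"
    by (simp add: four_block_mult_append_rows[OF A B C D w zX(1)] mult_smult_dim)
  moreover have "A * w + z1 \<cdot>\<^sub>m (B * X1) \<in> carrier_mat (N + r2) q"
    "C * w + z1 \<cdot>\<^sub>m (D * X1) \<in> carrier_mat r1 q" by auto
  ultimately have "four_block_mat A B C D * (w @\<^sub>r (z1 \<cdot>\<^sub>m X1)) = (Q @\<^sub>r X2) @\<^sub>r X1 \<longleftrightarrow>
      A * w + z1 \<cdot>\<^sub>m (B * X1) = Q @\<^sub>r X2 \<and> X1 = C * w + z1 \<cdot>\<^sub>m (D * X1)"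
    using append_rows_inject[OF _ _ QX X1] by metis
  also have "X1 = C * w + z1 \<cdot>\<^sub>m (D * X1) \<longleftrightarrow> X1 = Y * (C * w)"
    by (rule solve[OF X1]) auto
  also have "A * w + z1 \<cdot>\<^sub>m (B * X1) = Q @\<^sub>r X2 \<and> X1 = Y * (C * w) \<longleftrightarrow>
      (A + z1 \<cdot>\<^sub>m (B * (Y * C))) * w = Q @\<^sub>r X2 \<and> X1 = Y * (C * w)"
    by (auto simp: mat_alg smult_mult_dim)
  also have "(A + z1 \<cdot>\<^sub>m (B * (Y * C))) * w =
      (A' * W + z2 \<cdot>\<^sub>m (B' * X2)) @\<^sub>r (C' * W + z2 \<cdot>\<^sub>m (D' * X2))"
    using B' D' X2
    by (simp add: blocks w_def four_block_mult_append_rows[OF A' B' C' D' W zX(2)] mult_smult_dim)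
  also have "\<dots> = Q @\<^sub>r X2 \<longleftrightarrow> A' * W + z2 \<cdot>\<^sub>m (B' * X2) = Q \<and> C' * W + z2 \<cdot>\<^sub>m (D' * X2) = X2"
    by (rule append_rows_inject[OF _ _ Q X2]) (use A' B' C' D' W X2 in auto)
  finally show ?thesis unfolding w_def by auto
qed

lemma orthogonal_projection_four_block:
  "orthogonal_projection (four_block_mat (1\<^sub>m n) (0\<^sub>m n m) (0\<^sub>m m n) (0\<^sub>m m m))"
  "orthogonal_projection (four_block_mat (0\<^sub>m n n) (0\<^sub>m n m) (0\<^sub>m m n) (1\<^sub>m m))"
proof -
  let ?P = "four_block_mat (1\<^sub>m n) (0\<^sub>m n m) (0\<^sub>m m n) (0\<^sub>m m m) :: complex mat"
  let ?Q = "four_block_mat (0\<^sub>m n n) (0\<^sub>m n m) (0\<^sub>m m n) (1\<^sub>m m) :: complex mat"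
  have "?P * ?P = ?P" "?Q * ?Q = ?Q"
    by (subst mult_four_block_mat[of _ n n _ m _ m _ _ n _ m]; simp add: mat_alg)+
  moreover have "mat_adjoint ?P = ?P" "mat_adjoint ?Q = ?Q"
    by (intro eq_matI; auto)+
  ultimately show "orthogonal_projection ?P" "orthogonal_projection ?Q"
    by (simp_all add: orthogonal_projection_def)
qed

theorem theorem1p5:
  fixes N :: nat and S :: "complex poly poly mat"
  assumes "S \<in> carrier_mat N N"
    and "\<And>z1 z2. cmod z1 = 1 \<Longrightarrow> cmod z2 = 1 \<Longrightarrow>
           mat_adjoint (eval2_mat S z1 z2) * eval2_mat S z1 z2 = 1\<^sub>m N"
  shows "\<exists>(r::nat) A B C D P1 P2.
           A \<in> carrier_mat N N \<and> B \<in> carrier_mat N r \<and>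
           C \<in> carrier_mat r N \<and> D \<in> carrier_mat r r \<and>
           isometric_mat (four_block_mat A B C D) \<and>
           P1 \<in> carrier_mat r r \<and> P2 \<in> carrier_mat r r \<and>
           orthogonal_projection P1 \<and> orthogonal_projection P2 \<and> P1 + P2 = 1\<^sub>m r \<and>
           (\<forall>z1 z2. let \<Delta> = z1 \<cdot>\<^sub>m P1 + z2 \<cdot>\<^sub>m P2 in
              det (1\<^sub>m r - D * \<Delta>) = 1 \<and>
              eval2_mat S z1 z2 = A + B * \<Delta> * the (mat_inverse (1\<^sub>m r - D * \<Delta>)) * C)"
proof -
  note S = assms(1)
  obtain r2 n2 A2 B2 C2 D2 where
    A2: "A2 \<in> carrier_mat N N" and B2: "B2 \<in> carrier_mat N r2" and C2: "C2 \<in> carrier_mat r2 N"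
    and D2: "D2 \<in> carrier_mat r2 r2"
    and iso2: "\<And>z. cmod z = 1 \<Longrightarrow> isometric_mat (map_mat (\<lambda>p. poly p z) (four_block_mat A2 B2 C2 D2))"
    and S_coeff_0: "A2 = map_mat (\<lambda>p. coeff p 0) S"
    and S_coeff_Suc: "\<And>k. B2 * (D2 ^\<^sub>m k * C2) = map_mat (\<lambda>p. coeff p (Suc k)) S"
    and nil2: "D2 ^\<^sub>m n2 = 0\<^sub>m r2 r2"
    using kummert_step[OF S assms(2)] by metis
  define U where "U = four_block_mat A2 B2 C2 D2"
  have U: "U \<in> carrier_mat (N + r2) (N + r2)" using A2 B2 C2 D2 by (simp add: U_def)
  define U' where "U' = map_mat (map_poly (\<lambda>c. [:c:])) U"
  have U': "U' \<in> carrier_mat (N + r2) (N + r2)" using U by (simp add: U'_def)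
  have ev_U': "eval2_mat U' z1 z2 = map_mat (\<lambda>p. poly p z2) U" for z1 z2
    by (intro eq_matI) (auto simp: U'_def eval2_constant_in_z1)
  have "mat_adjoint (eval2_mat U' z1 z2) * eval2_mat U' z1 z2 = 1\<^sub>m (N + r2)"
    if "cmod z1 = 1" "cmod z2 = 1" for z1 z2
    using iso2[OF that(2)] U unfolding ev_U' U_def[symmetric] isometric_mat_def by simp
  \<comment> \<open>\<open>U'\<close> is \<open>U\<close> with its variable renamed to \<open>z\<^sub>2\<close>; it does not depend on \<open>z\<^sub>1\<close>, so
     the result may be evaluated at \<open>z\<^sub>1 = 1\<close>.\<close>
  from kummert_step[OF U' this] obtain r1 n1 A1 B1 C1 D1 where
    A1: "A1 \<in> carrier_mat (N + r2) (N + r2)" and B1: "B1 \<in> carrier_mat (N + r2) r1"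
    and C1: "C1 \<in> carrier_mat r1 (N + r2)" and D1: "D1 \<in> carrier_mat r1 r1"
    and iso1: "\<And>z. cmod z = 1 \<Longrightarrow> isometric_mat (map_mat (\<lambda>p. poly p z) (four_block_mat A1 B1 C1 D1))"
    and U_coeff_0: "A1 = map_mat (\<lambda>p. coeff p 0) U'"
    and U_coeff_Suc: "\<And>k. B1 * (D1 ^\<^sub>m k * C1) = map_mat (\<lambda>p. coeff p (Suc k)) U'"
    and nil1: "D1 ^\<^sub>m n1 = 0\<^sub>m r1 r1"
    by metis
  define ev where "ev z = map_mat (\<lambda>p :: complex poly. poly p z)" for z
  define A' B' C' D' where "A' = ev 1 A1" and "B' = ev 1 B1" and "C' = ev 1 C1" and "D' = ev 1 D1"
  have car': "A' \<in> carrier_mat (N + r2) (N + r2)" "B' \<in> carrier_mat (N + r2) r1"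
    "C' \<in> carrier_mat r1 (N + r2)" "D' \<in> carrier_mat r1 r1"
    using A1 B1 C1 D1 by (auto simp: A'_def B'_def C'_def D'_def ev_def)
  define Uf where "Uf = four_block_mat A' B' C' D'"
  have Uf: "Uf \<in> carrier_mat (N + (r2 + r1)) (N + (r2 + r1))" using car' by (auto simp: Uf_def)
  have iso: "isometric_mat Uf"
    using iso1[of 1] map_four_block_mat[OF A1 B1 C1 D1, of "\<lambda>p. poly p 1"]
    by (simp add: Uf_def A'_def B'_def C'_def D'_def ev_def)
  have U'_1: "map_mat (map_poly (\<lambda>q. poly q 1)) U' = U"
    by (intro eq_matI poly_eqI) (auto simp: U'_def coeff_map_poly)
  have A'_U: "A' = map_mat (\<lambda>p. coeff p 0) U"
    unfolding A'_def U_coeff_0 by (intro eq_matI) (auto simp: U'_def ev_def coeff_map_poly)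
  have moments_U: "B' * (D' ^\<^sub>m k * C') = map_mat (\<lambda>p. coeff p (Suc k)) U" for k
    using eval_moments[OF B1 C1 D1 U_coeff_Suc, of 1 k] unfolding U'_1
    by (simp add: B'_def C'_def D'_def ev_def)
  have nil': "D' ^\<^sub>m n1 = 0\<^sub>m r1 r1"
    unfolding D'_def ev_def by (rule eval_nilpotent[OF D1 nil1])
  define r where "r = r2 + r1"
  \<comment> \<open>The same matrix \<open>Uf\<close>, with the outer states moved from the signal spaces to the state space.\<close>
  obtain A B C D where split: "split_block Uf N N = (A, B, C, D)" by (metis prod_cases4)
  have car: "A \<in> carrier_mat N N" "B \<in> carrier_mat N r" "C \<in> carrier_mat r N" "D \<in> carrier_mat r r"
    and Uf_blocks: "Uf = four_block_mat A B C D"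
    using split_block[OF split, of r r] Uf by (auto simp: r_def)
  define P1 :: "complex mat" where "P1 = four_block_mat (0\<^sub>m r2 r2) (0\<^sub>m r2 r1) (0\<^sub>m r1 r2) (1\<^sub>m r1)"
  define P2 :: "complex mat" where "P2 = four_block_mat (1\<^sub>m r2) (0\<^sub>m r2 r1) (0\<^sub>m r1 r2) (0\<^sub>m r1 r1)"
  have P: "P1 \<in> carrier_mat r r" "P2 \<in> carrier_mat r r" by (auto simp: P1_def P2_def r_def)
  define \<Delta> where "\<Delta> z1 z2 = z1 \<cdot>\<^sub>m P1 + z2 \<cdot>\<^sub>m P2" for z1 z2
  have \<Delta>: "\<Delta> z1 z2 \<in> carrier_mat r r" for z1 z2 using P by (simp add: \<Delta>_def)
  have \<Delta>_mult: "\<Delta> z1 z2 * (X2 @\<^sub>r X1) = (z2 \<cdot>\<^sub>m X2) @\<^sub>r (z1 \<cdot>\<^sub>m X1)"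
    if X: "X2 \<in> carrier_mat r2 q" "X1 \<in> carrier_mat r1 q" for z1 z2 X1 X2 q
  proof -
    have "\<Delta> z1 z2 = four_block_mat (z2 \<cdot>\<^sub>m 1\<^sub>m r2) (0\<^sub>m r2 r1) (0\<^sub>m r1 r2) (z1 \<cdot>\<^sub>m 1\<^sub>m r1)"
      by (intro eq_matI) (auto simp: \<Delta>_def P1_def P2_def)
    then have "\<Delta> z1 z2 * (X2 @\<^sub>r X1) =
        ((z2 \<cdot>\<^sub>m 1\<^sub>m r2) * X2 + 0\<^sub>m r2 r1 * X1) @\<^sub>r (0\<^sub>m r1 r2 * X2 + (z1 \<cdot>\<^sub>m 1\<^sub>m r1) * X1)"
      using four_block_mult_append_rows[of "z2 \<cdot>\<^sub>m 1\<^sub>m r2" r2 r2 "0\<^sub>m r2 r1" r1 "0\<^sub>m r1 r2" r1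
          "z1 \<cdot>\<^sub>m 1\<^sub>m r1" X2 q X1] X by auto
    then show ?thesis using X by (simp add: smult_mult_dim one_mult_dim)
  qed
  have Uf_mult: "Uf * ((W @\<^sub>r (z2 \<cdot>\<^sub>m X2)) @\<^sub>r (z1 \<cdot>\<^sub>m X1)) =
      (A * W + B * (\<Delta> z1 z2 * (X2 @\<^sub>r X1))) @\<^sub>r (C * W + D * (\<Delta> z1 z2 * (X2 @\<^sub>r X1)))"
    if W: "W \<in> carrier_mat N q" and X: "X2 \<in> carrier_mat r2 q" "X1 \<in> carrier_mat r1 q" for W X1 X2 z1 z2 q
  proof -
    have zX: "z2 \<cdot>\<^sub>m X2 \<in> carrier_mat r2 q" "z1 \<cdot>\<^sub>m X1 \<in> carrier_mat r1 q" using X by auto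
    have "(z2 \<cdot>\<^sub>m X2) @\<^sub>r (z1 \<cdot>\<^sub>m X1) \<in> carrier_mat r q" using zX by (simp add: r_def)
    then show ?thesis
      unfolding append_rows_assoc[OF W zX] \<Delta>_mult[OF X] Uf_blocks
      by (rule four_block_mult_append_rows[OF car W])
  qed
  have inner_loop: "\<exists>Y. Y \<in> carrier_mat r1 r1 \<and>
      ev z1 U = A' + z1 \<cdot>\<^sub>m (B' * (Y * C')) \<and>
      (\<forall>X G l. X \<in> carrier_mat r1 l \<longrightarrow> G \<in> carrier_mat r1 l \<longrightarrow>
        (X = G + z1 \<cdot>\<^sub>m (D' * X) \<longleftrightarrow> X = Y * G))" for z1
    unfolding ev_def by (rule realization_one_variable[OF U A'_U car'(2-4) moments_U nil'])
  have ev_U: "ev z1 U = four_block_mat (ev z1 A2) (ev z1 B2) (ev z1 C2) (ev z1 D2)" for z1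
    unfolding ev_def U_def by (rule map_four_block_mat[OF A2 B2 C2 D2])
  have car2: "ev z1 A2 \<in> carrier_mat N N" "ev z1 B2 \<in> carrier_mat N r2"
    "ev z1 C2 \<in> carrier_mat r2 N" "ev z1 D2 \<in> carrier_mat r2 r2" for z1
    using A2 B2 C2 D2 by (auto simp: ev_def)
  have nil2': "ev z1 D2 ^\<^sub>m n2 = 0\<^sub>m r2 r2" for z1
    unfolding ev_def by (rule eval_nilpotent[OF D2 nil2])
  define solves where "solves z1 z2 Y \<longleftrightarrow>
      (\<forall>W Q X1 X2 q. W \<in> carrier_mat N q \<longrightarrow> Q \<in> carrier_mat N q \<longrightarrow>
        X2 \<in> carrier_mat r2 q \<longrightarrow> X1 \<in> carrier_mat r1 q \<longrightarrow>
        (Uf * ((W @\<^sub>r (z2 \<cdot>\<^sub>m X2)) @\<^sub>r (z1 \<cdot>\<^sub>m X1)) = (Q @\<^sub>r X2) @\<^sub>r X1 \<longleftrightarrow>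
          X1 = Y * (C' * (W @\<^sub>r (z2 \<cdot>\<^sub>m X2))) \<and> X2 = ev z1 C2 * W + z2 \<cdot>\<^sub>m (ev z1 D2 * X2) \<and>
          Q = ev z1 A2 * W + z2 \<cdot>\<^sub>m (ev z1 B2 * X2)))" for z1 z2 Y
  have loop: "\<exists>Y. Y \<in> carrier_mat r1 r1 \<and> solves z1 z2 Y" for z1 z2
  proof -
    obtain Y where Y: "Y \<in> carrier_mat r1 r1" "ev z1 U = A' + z1 \<cdot>\<^sub>m (B' * (Y * C'))"
      and solve: "\<forall>X G l. X \<in> carrier_mat r1 l \<longrightarrow> G \<in> carrier_mat r1 l \<longrightarrow>
        (X = G + z1 \<cdot>\<^sub>m (D' * X) \<longleftrightarrow> X = Y * G)" using inner_loop by blast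
    show ?thesis
      unfolding Uf_def solves_def
      by (intro exI[of _ Y] conjI Y(1) allI impI
          close_inner_loop[OF car' Y(1) solve[rule_format] trans[OF Y(2)[symmetric] ev_U] car2])
  qed
  have det: "det (1\<^sub>m r - D * \<Delta> z1 z2) = 1" for z1 z2
  proof (rule det_one_minus_eq_one)
    show "D * \<Delta> z1 z2 \<in> carrier_mat r r" using car \<Delta> by simp
    fix t X assume X: "X \<in> carrier_mat r 1" and fixp: "X = (t \<cdot>\<^sub>m (D * \<Delta> z1 z2)) * X"
    \<comment> \<open>The factor \<open>t\<close> is absorbed into the point \<open>(z\<^sub>1,z\<^sub>2)\<close>.\<close>
    let ?z1 = "t * z1" and ?z2 = "t * z2"
    have "t \<cdot>\<^sub>m \<Delta> z1 z2 = \<Delta> ?z1 ?z2"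
      using P by (intro eq_matI) (auto simp: \<Delta>_def algebra_simps)
    then have "X = D * (\<Delta> ?z1 ?z2 * X)"
      using fixp car \<Delta>[of z1 z2] \<Delta>[of ?z1 ?z2] X
      by (metis assoc_mult_mat mult_carrier_mat mult_smult_distrib)
    moreover obtain X2 X1 where X12: "X2 \<in> carrier_mat r2 1" "X1 \<in> carrier_mat r1 1" "X = X2 @\<^sub>r X1"
      using append_rows_split X unfolding r_def by blast
    ultimately have fixp': "D * (\<Delta> ?z1 ?z2 * (X2 @\<^sub>r X1)) = X2 @\<^sub>r X1" by simp
    define Q where "Q = B * (\<Delta> ?z1 ?z2 * (X2 @\<^sub>r X1))"
    have Q: "Q \<in> carrier_mat N 1" using car \<Delta>[of ?z1 ?z2] X X12 by (auto simp: Q_def)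
    have "Uf * ((0\<^sub>m N 1 @\<^sub>r (?z2 \<cdot>\<^sub>m X2)) @\<^sub>r (?z1 \<cdot>\<^sub>m X1)) = Q @\<^sub>r (X2 @\<^sub>r X1)"
      unfolding Uf_mult[OF zero_carrier_mat X12(1,2)] fixp'
      using car Q X X12 by (simp add: mat_alg Q_def[symmetric])
    also have "\<dots> = (Q @\<^sub>r X2) @\<^sub>r X1" by (rule append_rows_assoc[OF Q X12(1,2), symmetric])
    finally have eq: "Uf * ((0\<^sub>m N 1 @\<^sub>r (?z2 \<cdot>\<^sub>m X2)) @\<^sub>r (?z1 \<cdot>\<^sub>m X1)) = (Q @\<^sub>r X2) @\<^sub>r X1" .
    obtain Y where Y: "Y \<in> carrier_mat r1 r1" and solves: "solves ?z1 ?z2 Y"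
      using loop by blast
    note closed = iffD1[OF solves[unfolded solves_def, rule_format, OF zero_carrier_mat Q X12(1,2)] eq]
    have X1: "X1 = Y * (C' * (0\<^sub>m N 1 @\<^sub>r (?z2 \<cdot>\<^sub>m X2)))"
      by (rule conjunct1[OF closed])
    have X2: "X2 = ev ?z1 C2 * 0\<^sub>m N 1 + ?z2 \<cdot>\<^sub>m (ev ?z1 D2 * X2)"
      by (rule conjunct1[OF conjunct2[OF closed]])
    have "X2 = ?z2 \<cdot>\<^sub>m (ev ?z1 D2 * X2)"
      using X2 car2(3,4)[of ?z1] X12 by (simp add: mat_alg)
    then have X2_0: "X2 = 0\<^sub>m r2 1" by (rule nilpotent_no_kernel[OF car2(4) nil2' X12(1)])
    have "0\<^sub>m N 1 @\<^sub>r (?z2 \<cdot>\<^sub>m X2) = 0\<^sub>m (N + r2) 1"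
      by (intro eq_matI) (auto simp: X2_0 append_rows_def)
    then have "X1 = 0\<^sub>m r1 1" using X1 Y car' by (simp add: mat_alg)
    then show "X = 0\<^sub>m r 1"
      unfolding X12(3) X2_0 by (intro eq_matI) (auto simp: append_rows_def r_def)
  qed
  have real: "eval2_mat S z1 z2 = A + B * \<Delta> z1 z2 * the (mat_inverse (1\<^sub>m r - D * \<Delta> z1 z2)) * C" for z1 z2
  proof -
    define Sz where "Sz = map_mat (map_poly (\<lambda>q. poly q z1)) S"
    have Sz: "Sz \<in> carrier_mat N N" using S by (simp add: Sz_def)
    have S_eval: "eval2_mat S z1 z2 = map_mat (\<lambda>p. poly p z2) Sz"
      by (intro eq_matI) (auto simp: Sz_def eval2_conv_poly)
    have Sz0: "ev z1 A2 = map_mat (\<lambda>p. coeff p 0) Sz"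
      unfolding S_coeff_0 by (intro eq_matI) (auto simp: Sz_def ev_def coeff_map_poly)
    have SzSuc: "ev z1 B2 * (ev z1 D2 ^\<^sub>m k * ev z1 C2) = map_mat (\<lambda>p. coeff p (Suc k)) Sz" for k
      unfolding Sz_def ev_def by (rule eval_moments[OF B2 C2 D2 S_coeff_Suc])
    obtain Y2 where Y2: "Y2 \<in> carrier_mat r2 r2"
      and S_real: "map_mat (\<lambda>p. poly p z2) Sz = ev z1 A2 + z2 \<cdot>\<^sub>m (ev z1 B2 * (Y2 * ev z1 C2))"
      and solve2: "\<forall>X G l. X \<in> carrier_mat r2 l \<longrightarrow> G \<in> carrier_mat r2 l \<longrightarrow>
        (X = G + z2 \<cdot>\<^sub>m (ev z1 D2 * X) \<longleftrightarrow> X = Y2 * G)"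
      using realization_one_variable[OF Sz Sz0 car2(2-4) SzSuc nil2', of z2] by (elim exE conjE)
    define X2 where "X2 = Y2 * ev z1 C2"
    have X2: "X2 \<in> carrier_mat r2 N" using Y2 car2(3)[of z1] by (simp add: X2_def)
    obtain Y where Y: "Y \<in> carrier_mat r1 r1" and solves: "solves z1 z2 Y"
      using loop by blast
    \<comment> \<open>\<open>X2\<close> and \<open>X1\<close> are the states of the closed loop for the input \<open>I\<close>.\<close>
    define X1 where "X1 = Y * (C' * (1\<^sub>m N @\<^sub>r (z2 \<cdot>\<^sub>m X2)))"
    define Q where "Q = eval2_mat S z1 z2"
    have "1\<^sub>m N @\<^sub>r (z2 \<cdot>\<^sub>m X2) \<in> carrier_mat (N + r2) N" using X2 by simp
    then have X1: "X1 \<in> carrier_mat r1 N" using Y car' by (simp add: X1_def)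
    have Q: "Q \<in> carrier_mat N N" using S by (simp add: Q_def)
    have X2_eq: "X2 = ev z1 C2 * 1\<^sub>m N + z2 \<cdot>\<^sub>m (ev z1 D2 * X2)"
      using solve2[rule_format, OF X2 car2(3)] car2(3)[of z1] by (simp add: X2_def mult_one_dim)
    have Q_eq: "Q = ev z1 A2 * 1\<^sub>m N + z2 \<cdot>\<^sub>m (ev z1 B2 * X2)"
      using S_real car2(1)[of z1] by (simp add: Q_def S_eval X2_def mult_one_dim)
    have "Uf * ((1\<^sub>m N @\<^sub>r (z2 \<cdot>\<^sub>m X2)) @\<^sub>r (z1 \<cdot>\<^sub>m X1)) = (Q @\<^sub>r X2) @\<^sub>r X1"
      by (rule iffD2[OF solves[unfolded solves_def, rule_format, OF one_carrier_mat Q X2 X1]])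
        (intro conjI X1_def X2_eq Q_eq)
    also have "\<dots> = Q @\<^sub>r (X2 @\<^sub>r X1)" by (rule append_rows_assoc[OF Q X2 X1])
    finally have eq: "(A * 1\<^sub>m N + B * (\<Delta> z1 z2 * (X2 @\<^sub>r X1))) @\<^sub>r (C * 1\<^sub>m N + D * (\<Delta> z1 z2 * (X2 @\<^sub>r X1)))
        = Q @\<^sub>r (X2 @\<^sub>r X1)"
      unfolding Uf_mult[OF one_carrier_mat X2 X1] .
    define X where "X = X2 @\<^sub>r X1"
    have X: "X \<in> carrier_mat r N" using X1 X2 by (simp add: X_def r_def)
    have \<Delta>X: "\<Delta> z1 z2 * X \<in> carrier_mat r N" by (rule mult_carrier_mat[OF \<Delta> X])
    have AC: "A * 1\<^sub>m N = A" "C * 1\<^sub>m N = C" using car by (auto simp: mult_one_dim)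
    have "A + B * (\<Delta> z1 z2 * X) = Q \<and> C + D * (\<Delta> z1 z2 * X) = X"
      using eq append_rows_inject[of "A + B * (\<Delta> z1 z2 * X)" N N "C + D * (\<Delta> z1 z2 * X)" r Q X]
        car \<Delta>X Q X unfolding AC X_def[symmetric] by auto
    then have out: "Q = A + B * (\<Delta> z1 z2 * X)" and state: "X = C + (D * \<Delta> z1 z2) * X"
      by (simp_all add: assoc_mult_mat[OF car(4) \<Delta> X])
    let ?Y = "the (mat_inverse (1\<^sub>m r - D * \<Delta> z1 z2))"
    have D\<Delta>: "D * \<Delta> z1 z2 \<in> carrier_mat r r" using car \<Delta> by simp
    have Yc: "?Y \<in> carrier_mat r r" by (rule inverse_one_minus(1)[OF D\<Delta> det])
    have "X = ?Y * C" by (rule inverse_one_minus(3)[OF D\<Delta> det X car(3) state])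
    then have "Q = A + B * (\<Delta> z1 z2 * (?Y * C))" using out by simp
    also have "B * (\<Delta> z1 z2 * (?Y * C)) = B * \<Delta> z1 z2 * ?Y * C"
      using car \<Delta>[of z1 z2] Yc by (simp add: mult_assoc_dim)
    finally show ?thesis by (simp add: Q_def)
  qed
  have "P1 + P2 = 1\<^sub>m r"
    by (intro eq_matI) (auto simp: P1_def P2_def r_def)
  moreover have "orthogonal_projection P1" "orthogonal_projection P2"
    unfolding P1_def P2_def by (rule orthogonal_projection_four_block)+
  ultimately have "A \<in> carrier_mat N N \<and> B \<in> carrier_mat N r \<and>
           C \<in> carrier_mat r N \<and> D \<in> carrier_mat r r \<and>
           isometric_mat (four_block_mat A B C D) \<and>
           P1 \<in> carrier_mat r r \<and> P2 \<in> carrier_mat r r \<and>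
           orthogonal_projection P1 \<and> orthogonal_projection P2 \<and> P1 + P2 = 1\<^sub>m r \<and>
           (\<forall>z1 z2. let \<Delta> = z1 \<cdot>\<^sub>m P1 + z2 \<cdot>\<^sub>m P2 in
              det (1\<^sub>m r - D * \<Delta>) = 1 \<and>
              eval2_mat S z1 z2 = A + B * \<Delta> * the (mat_inverse (1\<^sub>m r - D * \<Delta>)) * C)"
    using car P iso det real unfolding Uf_blocks \<Delta>_def Let_def by auto
  then show ?thesis by (intro exI)
qed

end
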